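(* Let $H$ be a finite graph without multiple edges, possibly with loops, with no isolated vertices, and with maximum degree $\Delta$ (loops counting once toward the degree). Let $D \geq 1$. For any $G \in \mathcal{G}(n,1,D)$, \[ \hom(G,H) \leq \max \{ \hom(K_{2},H)^{\frac{n}{2}}, \hom(K_{1,D},H)^{\frac{n}{1+D}} \}, \] with the cases of equality being those of the corresponding theorem for $n$-vertex graphs ($n \geq 2$) of minimum degree $1$ with no maximum degree condition, where $K_{1,n-1}$ is replaced by $\frac{n}{1+D}K_{1,D}$. That is: \begin{enumerate} \item If $H \neq K_{\Delta}^{\text{loop}}$ satisfies $\hom(K_2,H) \geq \Delta^2$, then equality holds only for $G = \frac{n}{2}K_2$. \item If $H$ satisfies $\hom(K_2,H) < \Delta^2$, let $n_0 = n_0(H)$ be the smallest integer in $\{3,4,\ldots\}$ satisfying $\hom(K_2,H) < \hom(K_{1,n_0-1},H)^{\frac{2}{n_0}}$. \begin{enumerate} \item If $2 \leq n < n_0$, then equality holds only for $G = \frac{n}{2}K_2$ [unless $n = n_0-1$ and $\hom(K_2,H) = \hom(K_{1,n_0-2},H)^{\frac{2}{n_0-1}}$, in which case $G = \frac{n}{1+D}K_{1,D}$ also achieves equality]. \item If $n \geq n_0$, then equality holds only for $G = \frac{n}{1+D}K_{1,D}$. \end{enumerate} \end{enumerate}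
   Context: For a finite simple (loopless) graph $G$ and a finite graph $H$ (no multiple edges, loops allowed), $\hom(G,H)$ is the number of maps $f:V(G)\to V(H)$ such that $v\sim_G w$ implies $f(v)\sim_H f(w)$. For $v\in V(H)$, $d(v)$ is the degree of $v$, where a loop counts once; $\Delta=\max_{v\in V(H)} d(v)$. A vertex of $H$ is isolated if it is incident to no edge and no loop. $\mathcal{G}(n,\delta,D)$ is the set of graphs on $n$ vertices (finite, simple) with minimum degree $\delta$ and maximum degree at most $D$. $K_\Delta^{\text{loop}}$ is the fully looped complete graph on $\Delta$ vertices. $K_2$ is a single edge, and $K_{a,b}$ is the complete bipartite graph with parts of sizes $a$ and $b$. For a $k$-vertex graph $F$, $\frac{n}{k}F$ is the disjoint union of $n/k$ copies of $F$.
   Formalization: In case 2 the number compared with n_0 (and n_0-1) is D+1 instead of n, since the list with n is false (e.g. 3K_2 can attain equality with n=6≥n_0=4, D=2); in the bracketed case K_2 and K_{1,D} copies both attain equality, and any extremal G is a disjoint union of copies of K_2 and K_{1,D}. *)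

theory Defs
  imports Complex_Main "HOL-Library.FuncSet"
    "Graph_Theory.Pair_Digraph" "Graph_Theory.Digraph_Isomorphism"
begin

text \<open>
  As in Graph_Theory, an undirected graph is a symmetric set of arcs: a finite simple graph is a
  \<open>pair_graph\<close>, and a finite graph with loops allowed but no multiple edges is a
  \<open>pair_pseudo_graph\<close>.  A loop at \<open>v\<close> is the single arc \<open>(v, v)\<close>, so \<open>out_degree\<close> counts it once.
\<close>

abbreviation deg :: "'a pair_pre_digraph \<Rightarrow> 'a \<Rightarrow> nat" where
  "deg G v \<equiv> out_degree (with_proj G) v"

definition max_deg :: "'a pair_pre_digraph \<Rightarrow> nat" where
  "max_deg G = Max (deg G ` pverts G)"

definition min_deg :: "'a pair_pre_digraph \<Rightarrow> nat" where
  "min_deg G = Min (deg G ` pverts G)"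

definition isolated :: "'a pair_pre_digraph \<Rightarrow> 'a \<Rightarrow> bool" where
  "isolated G v \<longleftrightarrow> v \<in> pverts G \<and> (\<forall>e \<in> parcs G. fst e \<noteq> v \<and> snd e \<noteq> v)"

text \<open>The minimum degree is exactly \<open>\<delta>\<close>; the maximum degree is at most \<open>D\<close>.\<close>

definition graph_class :: "nat \<Rightarrow> nat \<Rightarrow> nat \<Rightarrow> 'a pair_pre_digraph set" where
  "graph_class n \<delta> D = {G. pair_graph G \<and> pverts G \<noteq> {} \<and> card (pverts G) = n
     \<and> min_deg G = \<delta> \<and> max_deg G \<le> D}"

text \<open>Homomorphisms are made extensional so that each map on \<open>V(G)\<close> is counted once.\<close>

definition homs :: "'a pair_pre_digraph \<Rightarrow> 'b pair_pre_digraph \<Rightarrow> ('a \<Rightarrow> 'b) set" where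
  "homs G H = {f \<in> pverts G \<rightarrow>\<^sub>E pverts H. \<forall>(v, w) \<in> parcs G. (f v, f w) \<in> parcs H}"

definition hom :: "'a pair_pre_digraph \<Rightarrow> 'b pair_pre_digraph \<Rightarrow> nat" where
  "hom G H = card (homs G H)"

abbreviation graph_iso :: "'a pair_pre_digraph \<Rightarrow> 'b pair_pre_digraph \<Rightarrow> bool" where
  "graph_iso G H \<equiv> digraph_iso (with_proj G) (with_proj H)"

definition K2 :: "nat pair_pre_digraph" where
  "K2 = \<lparr> pverts = {0, 1}, parcs = {(0, 1), (1, 0)} \<rparr>"

definition complete_bipartite :: "nat \<Rightarrow> nat \<Rightarrow> (nat + nat) pair_pre_digraph" where
  "complete_bipartite a b =
     \<lparr> pverts = {..<a} <+> {..<b},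
       parcs = {(Inl i, Inr j) | i j. i < a \<and> j < b} \<union> {(Inr j, Inl i) | i j. i < a \<and> j < b} \<rparr>"

definition looped_complete :: "nat \<Rightarrow> nat pair_pre_digraph" where
  "looped_complete k = \<lparr> pverts = {..<k}, parcs = {..<k} \<times> {..<k} \<rparr>"

definition copies :: "nat \<Rightarrow> 'a pair_pre_digraph \<Rightarrow> (nat \<times> 'a) pair_pre_digraph" where
  "copies m F = \<lparr> pverts = {..<m} \<times> pverts F,
     parcs = {((i, v), (i, w)) | i v w. i < m \<and> (v, w) \<in> parcs F} \<rparr>"

definition disjoint_union ::
    "'a pair_pre_digraph \<Rightarrow> 'b pair_pre_digraph \<Rightarrow> ('a + 'b) pair_pre_digraph" where
  "disjoint_union F F' = \<lparr> pverts = pverts F <+> pverts F',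
     parcs = {(Inl v, Inl w) | v w. (v, w) \<in> parcs F} \<union>
             {(Inr v, Inr w) | v w. (v, w) \<in> parcs F'} \<rparr>"

text \<open>
  \<open>G = (n/k) F\<close> up to isomorphism, where \<open>G\<close> has \<open>n\<close> and \<open>F\<close> has \<open>k\<close> vertices; this is false
  when \<open>k\<close> does not divide \<open>n\<close>.
\<close>

definition is_copies_of :: "'a pair_pre_digraph \<Rightarrow> 'b pair_pre_digraph \<Rightarrow> bool" where
  "is_copies_of G F \<longleftrightarrow> card (pverts F) dvd card (pverts G) \<and>
     graph_iso G (copies (card (pverts G) div card (pverts F)) F)"

definition hom_bound :: "nat \<Rightarrow> nat \<Rightarrow> 'b pair_pre_digraph \<Rightarrow> real" where
  "hom_bound n D H = max (real (hom K2 H) powr (real n / 2))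
     (real (hom (complete_bipartite 1 D) H) powr (real n / real (1 + D)))"

definition attains_bound :: "nat \<Rightarrow> nat \<Rightarrow> 'a pair_pre_digraph \<Rightarrow> 'b pair_pre_digraph \<Rightarrow> bool" where
  "attains_bound n D G H \<longleftrightarrow> real (hom G H) = hom_bound n D H"

definition star_beats_edges :: "'b pair_pre_digraph \<Rightarrow> nat \<Rightarrow> bool" where
  "star_beats_edges H m \<longleftrightarrow> m \<ge> 3 \<and>
     real (hom K2 H) < real (hom (complete_bipartite 1 (m - 1)) H) powr (2 / real m)"

text \<open>\<open>n\<^sub>0 = n\<^sub>0(H)\<close>, stated as a predicate, so that its existence is not presupposed.\<close>

definition is_n0 :: "'b pair_pre_digraph \<Rightarrow> nat \<Rightarrow> bool" where
  "is_n0 H n0 \<longleftrightarrow> star_beats_edges H n0 \<and> (\<forall>m. star_beats_edges H m \<longrightarrow> n0 \<le> m)"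

end

theory Submission
  imports Defs
begin

text \<open>
  Since no vertex of \<open>G\<close> is isolated, \<open>G\<close> has a spanning star forest, and deleting edges only
  increases the number of homomorphisms.  A star with \<open>k\<close> leaves contributes the power sum
  \<open>S\<^sub>k = (\<Sum>x. deg x ^ k)\<close> of the degrees of \<open>H\<close>, and \<open>k \<mapsto> S\<^sub>k\<close> is log-convex, so \<open>S\<^sub>k powr (1 / (k + 1))\<close>
  is largest at \<open>k = 1\<close> or \<open>k = D\<close>, and only there unless \<open>H\<close> is a looped complete graph.
  In the case of equality every homomorphism of the star forest is one of \<open>G\<close>.  This rules out arcs
  of \<open>G\<close> between different stars as soon as \<open>H\<close> is not looped complete, and arcs between two leaves
  of one star as soon as some vertex of \<open>H\<close> has two non-adjacent neighbours (equal neighbours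
  without a loop included), which is the case if \<open>S\<^sub>1 < \<Delta>\<^sup>2\<close>.
\<close>

section \<open>Graph isomorphisms and homomorphisms\<close>

text \<open>\<open>digraph_iso\<close> carries separate vertex and arc maps. Arcs here are pairs
  with ends \<open>fst\<close> and \<open>snd\<close>, so the vertex map forces the arc map to be
  \<open>map_prod \<phi> \<phi>\<close>.\<close>

lemma graph_iso_iff:
  "graph_iso G G' \<longleftrightarrow> wf_digraph (with_proj G) \<and>
     (\<exists>\<phi>. bij_betw \<phi> (pverts G) (pverts G') \<and> parcs G' = map_prod \<phi> \<phi> ` parcs G)"
proof
  assume "graph_iso G G'"
  then obtain h where h: "pre_digraph.digraph_isomorphism (with_proj G) h" and app: "with_proj G' = app_iso h (with_proj G)"
    unfolding digraph_iso_def by auto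
  have "iso_tail h = fst" "iso_head h = snd"
    using arg_cong[OF app, of tail] arg_cong[OF app, of head] by simp_all
  then have arc: "iso_arcs h a = map_prod (iso_verts h) (iso_verts h) a" if "a \<in> parcs G" for a
    using h that unfolding pre_digraph.digraph_isomorphism_def
    by (metis map_prod_simp prod.collapse with_proj_simps(2,4,5))
  have "pverts G' = iso_verts h ` pverts G" "parcs G' = iso_arcs h ` parcs G"
    using arg_cong[OF app, of verts] arg_cong[OF app, of arcs] by simp_all
  moreover have "wf_digraph (with_proj G)" "inj_on (iso_verts h) (pverts G)"
    using h unfolding pre_digraph.digraph_isomorphism_def by auto
  ultimately show "wf_digraph (with_proj G) \<and>
     (\<exists>\<phi>. bij_betw \<phi> (pverts G) (pverts G') \<and> parcs G' = map_prod \<phi> \<phi> ` parcs G)"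
    using arc unfolding bij_betw_def by (intro conjI exI[of _ "iso_verts h"]) auto
next
  assume "wf_digraph (with_proj G) \<and>
     (\<exists>\<phi>. bij_betw \<phi> (pverts G) (pverts G') \<and> parcs G' = map_prod \<phi> \<phi> ` parcs G)"
  then obtain \<phi> where wf: "wf_digraph (with_proj G)" and \<phi>: "inj_on \<phi> (pverts G)" "\<phi> ` pverts G = pverts G'"
    and arcs: "parcs G' = map_prod \<phi> \<phi> ` parcs G"
    unfolding bij_betw_def by auto
  have "parcs G \<subseteq> pverts G \<times> pverts G"
    using wf unfolding wf_digraph_def by fastforce
  then have "inj_on (map_prod \<phi> \<phi>) (parcs G)"
    using map_prod_inj_on[OF \<phi>(1) \<phi>(1)] inj_on_subset by blast
  then show "graph_iso G G'"
    unfolding digraph_iso_def pre_digraph.digraph_isomorphism_def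
    using wf \<phi> arcs
    by (intro exI[of _ "\<lparr>iso_verts = \<phi>, iso_arcs = map_prod \<phi> \<phi>, iso_head = snd, iso_tail = fst\<rparr>"])
       (auto simp: app_iso_def with_proj_def)
qed

text \<open>Homomorphisms are transported by composing with the inverse bijection;
  \<open>restrict\<close> keeps the results extensional.\<close>

lemma hom_graph_iso:
  assumes "graph_iso G G'"
  shows "hom G H = hom G' H"
proof -
  obtain \<phi> where wf: "parcs G \<subseteq> pverts G \<times> pverts G" and \<phi>: "bij_betw \<phi> (pverts G) (pverts G')"
    and arcs: "parcs G' = map_prod \<phi> \<phi> ` parcs G"
    using assms unfolding graph_iso_iff wf_digraph_def by fastforce
  define \<psi> where "\<psi> = the_inv_into (pverts G) \<phi>"
  have \<psi>: "\<psi> (\<phi> v) = v" if "v \<in> pverts G" for v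
    using \<phi> that unfolding \<psi>_def bij_betw_def by (simp add: the_inv_into_f_f)
  have \<phi>_mem: "\<phi> v \<in> pverts G'" if "v \<in> pverts G" for v
    using \<phi> that bij_betwE by blast
  have mem: "v \<in> pverts G" "w \<in> pverts G" if "(v, w) \<in> parcs G" for v w
    using wf that by auto
  have \<psi>': "\<phi> (\<psi> w) = w" "\<psi> w \<in> pverts G" if "w \<in> pverts G'" for w
    using \<phi> that f_the_inv_into_f_bij_betw the_inv_into_into unfolding \<psi>_def bij_betw_def
    by (metis f_the_inv_into_f, metis order_refl the_inv_into_into)
  have "bij_betw (\<lambda>f. restrict (f \<circ> \<psi>) (pverts G')) (homs G H) (homs G' H)"
  proof (rule bij_betw_byWitness[where f' = "\<lambda>f. restrict (f \<circ> \<phi>) (pverts G)"])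
    show "\<forall>f\<in>homs G H. restrict (restrict (f \<circ> \<psi>) (pverts G') \<circ> \<phi>) (pverts G) = f"
      by (auto simp: homs_def fun_eq_iff \<psi> \<phi>_mem restrict_def PiE_def extensional_def)
    show "\<forall>f\<in>homs G' H. restrict (restrict (f \<circ> \<phi>) (pverts G) \<circ> \<psi>) (pverts G') = f"
      by (auto simp: homs_def fun_eq_iff \<psi>' restrict_def PiE_def extensional_def)
    show "(\<lambda>f. restrict (f \<circ> \<psi>) (pverts G')) ` homs G H \<subseteq> homs G' H"
      using mem by (fastforce simp: homs_def arcs \<psi> \<psi>' \<phi>_mem PiE_iff)
    show "(\<lambda>f. restrict (f \<circ> \<phi>) (pverts G)) ` homs G' H \<subseteq> homs G H"
      using mem by (auto simp: homs_def arcs \<phi>_mem PiE_iff)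
  qed
  then show ?thesis
    unfolding hom_def by (rule bij_betw_same_card)
qed

lemma deg_eq_card_Image: "deg H x = card (parcs H `` {x})"
proof -
  have "out_arcs (with_proj H) x = Pair x ` (parcs H `` {x})"
    unfolding out_arcs_def by auto
  then show ?thesis
    unfolding out_degree_def by (simp add: card_image inj_on_def)
qed

lemma finite_homs: "finite (pverts G) \<Longrightarrow> finite (pverts H) \<Longrightarrow> finite (homs G H)"
  unfolding homs_def by (rule finite_subset[of _ "pverts G \<rightarrow>\<^sub>E pverts H"]) (auto intro: finite_PiE)

lemma homs_antimono:
  "pverts G = pverts G' \<Longrightarrow> parcs G \<subseteq> parcs G' \<Longrightarrow> homs G' H \<subseteq> homs G H"
  unfolding homs_def by auto

section \<open>Star forests\<close>

text \<open>
  A disjoint union of stars is encoded by the idempotent map \<open>p\<close> sending each vertex to the centre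
  of its star; of the two vertices of a component \<open>K\<^sub>2\<close>, one is chosen as the centre.
\<close>

definition star_map :: "'a set \<Rightarrow> ('a \<Rightarrow> 'a) \<Rightarrow> bool" where
  "star_map V p \<longleftrightarrow> finite V \<and> p ` V \<subseteq> V \<and> (\<forall>v\<in>V. p (p v) = p v) \<and>
     (\<forall>c\<in>V. p c = c \<longrightarrow> (\<exists>v\<in>V. v \<noteq> c \<and> p v = c))"

definition star_forest :: "'a set \<Rightarrow> ('a \<Rightarrow> 'a) \<Rightarrow> 'a pair_pre_digraph" where
  "star_forest V p = \<lparr> pverts = V,
     parcs = {(v, p v) | v. v \<in> V \<and> p v \<noteq> v} \<union> {(p v, v) | v. v \<in> V \<and> p v \<noteq> v} \<rparr>"

definition centres :: "'a set \<Rightarrow> ('a \<Rightarrow> 'a) \<Rightarrow> 'a set" where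
  "centres V p = {c \<in> V. p c = c}"

definition leaves :: "'a set \<Rightarrow> ('a \<Rightarrow> 'a) \<Rightarrow> 'a \<Rightarrow> 'a set" where
  "leaves V p c = {v \<in> V. p v = c \<and> v \<noteq> c}"

definition power_sum :: "'b pair_pre_digraph \<Rightarrow> nat \<Rightarrow> nat" where
  "power_sum H k = (\<Sum>x\<in>pverts H. deg H x ^ k)"

lemma star_forest_simps [simp]:
  "pverts (star_forest V p) = V"
  "parcs (star_forest V p) = {(v, p v) | v. v \<in> V \<and> p v \<noteq> v} \<union> {(p v, v) | v. v \<in> V \<and> p v \<noteq> v}"
  by (simp_all add: star_forest_def)

lemma wf_star_forest: "p ` V \<subseteq> V \<Longrightarrow> wf_digraph (with_proj (star_forest V p))"
  by (auto simp: wf_digraph_def)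

lemma star_map_leaves:
  assumes "star_map V p" "c \<in> centres V p"
  shows "finite (leaves V p c)" "leaves V p c \<noteq> {}" "card (leaves V p c) \<ge> 1"
proof -
  show *: "finite (leaves V p c)" "leaves V p c \<noteq> {}"
    using assms by (auto simp: star_map_def leaves_def centres_def)
  then show "card (leaves V p c) \<ge> 1"
    by (simp add: Suc_le_eq card_gt_0_iff)
qed

section \<open>Existence of spanning star forests\<close>

definition spanning_star_map :: "'a rel \<Rightarrow> 'a set \<Rightarrow> ('a \<Rightarrow> 'a) \<Rightarrow> bool" where
  "spanning_star_map E W p \<longleftrightarrow> star_map W p \<and> (\<forall>v\<in>W. p v \<noteq> v \<longrightarrow> (v, p v) \<in> E)"

text \<open>An augmentation step: the vertices of \<open>K\<close> leave their stars and are
  gathered in the star with centre \<open>u\<close>. \<open>stay\<close> keeps the new map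
  idempotent, and \<open>leaf\<close> ensures that centres outside \<open>K\<close> still have a
  leaf.\<close>

lemma spanning_star_map_redirect:
  assumes p: "spanning_star_map E W p"
    and K: "u \<in> K" "v \<in> K" "u \<noteq> v" "finite K" "\<And>w. w \<in> K \<Longrightarrow> w \<noteq> u \<Longrightarrow> (w, u) \<in> E"
    and stay: "\<And>w. w \<in> W - K \<Longrightarrow> p w \<in> K \<Longrightarrow> p w = u"
    and leaf: "\<And>c. c \<in> W - K \<Longrightarrow> p c = c \<Longrightarrow> \<exists>w\<in>W - K. w \<noteq> c \<and> p w = c"
  shows "spanning_star_map E (W \<union> K) (\<lambda>w. if w \<in> K then u else p w)" (is "spanning_star_map E _ ?q")
proof -
  have p': "finite W" "\<And>w. w \<in> W \<Longrightarrow> p w \<in> W" "\<And>w. w \<in> W \<Longrightarrow> p (p w) = p w"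
    "\<And>w. w \<in> W \<Longrightarrow> p w \<noteq> w \<Longrightarrow> (w, p w) \<in> E"
    using p by (auto simp: spanning_star_map_def star_map_def)
  have "\<exists>w\<in>W \<union> K. w \<noteq> c \<and> ?q w = c" if c: "c \<in> W \<union> K" "?q c = c" for c
  proof (cases "c \<in> K")
    case True
    then show ?thesis
      using c K(1-3) by (intro bexI[of _ v]) auto
  next
    case False
    then have "c \<in> W - K" "p c = c"
      using c by auto
    then obtain w where "w \<in> W - K" "w \<noteq> c" "p w = c"
      using leaf by blast
    then show ?thesis
      by (intro bexI[of _ w]) auto
  qed
  moreover have "?q ` (W \<union> K) \<subseteq> W \<union> K" "\<forall>w\<in>W \<union> K. ?q (?q w) = ?q w"
    "\<forall>w\<in>W \<union> K. ?q w \<noteq> w \<longrightarrow> (w, ?q w) \<in> E"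
    using p' K stay by auto
  ultimately show ?thesis
    using p'(1) K(4) unfolding spanning_star_map_def star_map_def by blast
qed

text \<open>If a maximal covered set \<open>W\<close> missed \<open>v\<close>, a neighbour
  \<open>u\<close> of \<open>v\<close> could absorb it: an uncovered \<open>u\<close> starts a new
  star, a centre \<open>u\<close> gains a leaf, and a leaf \<open>u\<close> leaves its star to
  become a centre for \<open>v\<close>.\<close>

lemma spanning_star_map_exists:
  assumes "finite V" "sym E" and nbr: "\<forall>v\<in>V. \<exists>w\<in>V. w \<noteq> v \<and> (v, w) \<in> E"
  obtains p where "spanning_star_map E V p"
proof -
  define \<W> where "\<W> = {W. W \<subseteq> V \<and> (\<exists>p. spanning_star_map E W p)}"
  have "finite \<W>" "\<W> \<noteq> {}"
    using assms(1) by (auto simp: \<W>_def spanning_star_map_def star_map_def)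
  then obtain W where W: "W \<in> \<W>" and max: "\<forall>W'\<in>\<W>. W \<subseteq> W' \<longrightarrow> W = W'"
    by (metis finite_has_maximal)
  then obtain p where p: "spanning_star_map E W p" "W \<subseteq> V"
    by (auto simp: \<W>_def)
  have "W = V"
  proof (rule ccontr)
    assume "W \<noteq> V"
    then obtain v where v: "v \<in> V" "v \<notin> W"
      using p by auto
    then obtain u where u: "u \<in> V" "u \<noteq> v" "(v, u) \<in> E"
      using nbr by blast
    have pW: "\<And>w. w \<in> W \<Longrightarrow> p w \<in> W" "\<And>w. w \<in> W \<Longrightarrow> p (p w) = p w"
      "\<And>c. c \<in> W \<Longrightarrow> p c = c \<Longrightarrow> \<exists>w\<in>W. w \<noteq> c \<and> p w = c"
      "\<And>w. w \<in> W \<Longrightarrow> p w \<noteq> w \<Longrightarrow> (p w, w) \<in> E"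
      using p assms(2) by (auto simp: spanning_star_map_def star_map_def dest: symD)
    \<comment> \<open>If \<open>u\<close> is the only leaf of its star, its departure would leave
      the centre \<open>p u\<close> bare, so \<open>p u\<close> moves too and becomes a leaf of
      \<open>u\<close>.\<close>
    define K where "K = {u, v} \<union>
      (if u \<in> W \<and> p u \<noteq> u \<and> (\<forall>w\<in>W. p w = p u \<longrightarrow> w = u \<or> w = p u) then {p u} else {})"
    have "spanning_star_map E (W \<union> K) (\<lambda>w. if w \<in> K then u else p w)"
    proof (rule spanning_star_map_redirect[OF p(1), of u K v])
      show "(w, u) \<in> E" if "w \<in> K" "w \<noteq> u" for w
        using that pW(4)[of u] u by (auto simp: K_def split: if_splits)
      show "p w = u" if "w \<in> W - K" "p w \<in> K" for w
        using that pW(1,2)[of w] v by (auto simp: K_def split: if_splits)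
      show "\<exists>w\<in>W - K. w \<noteq> c \<and> p w = c" if c: "c \<in> W - K" "p c = c" for c
      proof -
        obtain w where w: "w \<in> W" "w \<noteq> c" "p w = c"
          using c pW(3) by blast
        have wv: "w \<noteq> v"
          using w v by auto
        show ?thesis
        proof (cases "w \<in> K")
          case False
          then show ?thesis
            using w by blast
        next
          case True
          then have "w = u \<or> p u = c"
            using w wv pW(2)[of u] by (auto simp: K_def split: if_splits)
          then have "u \<in> W" "p u = c" "c \<noteq> u"
            using w c True wv by (auto simp: K_def split: if_splits)
          \<comment> \<open>The absorbed leaf of \<open>c\<close> is \<open>u\<close>, and
            \<open>c = p u\<close> lies outside \<open>K\<close>. By the choice of \<open>K\<close>,
            the star of \<open>c\<close> then has another leaf \<open>w'\<close>.\<close>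
          moreover from this c obtain w' where "w' \<in> W" "p w' = p u" "w' \<noteq> u" "w' \<noteq> p u"
            by (auto simp: K_def split: if_splits)
          ultimately show ?thesis
            using v by (intro bexI[of _ w']) (auto simp: K_def)
        qed
      qed
    qed (use u in \<open>auto simp: K_def\<close>)
    moreover have "W \<union> K \<subseteq> V"
      using p(2) u v pW(1)[of u] by (auto simp: K_def)
    ultimately have "W \<union> K \<in> \<W>"
      by (auto simp: \<W>_def)
    then have "W = W \<union> K"
      using max by blast
    then show False
      using v by (auto simp: K_def)
  qed
  then show ?thesis
    using p that by blast
qed

section \<open>Counting vertices and homomorphisms star by star\<close>

lemma star_mapD:
  assumes "star_map V p"
  shows "finite V" "v \<in> V \<Longrightarrow> p v \<in> V" "v \<in> V \<Longrightarrow> p (p v) = p v" "v \<in> V \<Longrightarrow> p v \<in> centres V p"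
  using assms by (auto simp: star_map_def centres_def)

lemma parcs_star_forest:
  "parcs (star_forest V p) = (\<lambda>v. (v, p v)) ` (V - centres V p) \<union> (\<lambda>v. (p v, v)) ` (V - centres V p)"
  by (auto simp: centres_def)

lemma leaves_eq: "star_map V p \<Longrightarrow> c \<in> centres V p \<Longrightarrow> leaves V p c = {v \<in> V - centres V p. p v = c}"
  by (auto simp: leaves_def centres_def star_map_def)

lemma card_star_map:
  assumes "star_map V p"
  shows "card V = (\<Sum>c\<in>centres V p. card (leaves V p c) + 1)"
proof -
  have fin: "finite (centres V p)" "finite V"
    using star_mapD(1)[OF assms] by (auto simp: centres_def)
  have "(\<Sum>c\<in>centres V p. card (leaves V p c)) = (\<Sum>c\<in>centres V p. \<Sum>v\<in>{v\<in>V - centres V p. p v = c}. 1)"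
    using leaves_eq[OF assms] by simp
  also have "\<dots> = (\<Sum>v\<in>V - centres V p. 1)"
    using fin star_mapD(4)[OF assms] by (intro sum.group) auto
  finally show ?thesis
    using fin card_Diff_subset[of "centres V p" V] card_mono[of V "centres V p"]
    by (simp add: sum_Suc centres_def)
qed

text \<open>A homomorphism is a choice \<open>g\<close> of images for the centres and, independently
  for each leaf \<open>v\<close>, of a neighbour of \<open>g (p v)\<close>. The resulting sum over
  \<open>g\<close> of products of degrees is grouped by stars and factors by distributivity.\<close>

lemma hom_star_forest:
  assumes p: "star_map V p" and H: "pair_pseudo_graph H"
  shows "hom (star_forest V p) H = (\<Prod>c\<in>centres V p. power_sum H (card (leaves V p c)))"
proof -
  interpret pair_pseudo_graph H by fact
  define C where "C = centres V p"
  define L where "L = V - C"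
  define N where "N x = parcs H `` {x}" for x
  have finH: "finite (pverts H)"
    by (rule pair_finite_verts)
  have N: "N x \<subseteq> pverts H" "finite (N x)" for x
    using finH by (auto simp: N_def in_arcsD2 intro: finite_subset)
  have C: "finite C" "finite L" "C \<subseteq> V" "\<And>v. v \<in> V \<Longrightarrow> p v \<in> C" "V = C \<union> L" "C \<inter> L = {}"
    using star_mapD[OF p] by (auto simp: C_def L_def centres_def)
  have memV: "v \<in> V \<longleftrightarrow> v \<in> C \<or> v \<in> L" for v
    using C(5) by blast
  have symH: "(x, y) \<in> parcs H \<longleftrightarrow> (y, x) \<in> parcs H" for x y
    using pair_sym_arcs unfolding symmetric_def by (auto dest: symD)
  have arcs: "f \<in> homs (star_forest V p) H \<longleftrightarrow> f \<in> V \<rightarrow>\<^sub>E pverts H \<and> (\<forall>v\<in>L. f v \<in> N (f (p v)))" for f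
    using symH by (auto simp: homs_def parcs_star_forest L_def C_def N_def ball_Un simp del: star_forest_simps(2))
  have "bij_betw (\<lambda>f. (restrict f C, restrict f L)) (homs (star_forest V p) H)
          (Sigma (C \<rightarrow>\<^sub>E pverts H) (\<lambda>g. PiE L (\<lambda>v. N (g (p v)))))"
  proof (rule bij_betw_byWitness[where f' = "\<lambda>(g, h) v. if v \<in> C then g v else h v"])
    show "\<forall>f\<in>homs (star_forest V p) H.
        (\<lambda>(g, h) v. if v \<in> C then g v else h v) (restrict f C, restrict f L) = f"
      using memV by (auto simp: arcs PiE_iff extensional_def fun_eq_iff)
    show "\<forall>gh\<in>Sigma (C \<rightarrow>\<^sub>E pverts H) (\<lambda>g. PiE L (\<lambda>v. N (g (p v)))).
        (\<lambda>f. (restrict f C, restrict f L)) ((\<lambda>(g, h) v. if v \<in> C then g v else h v) gh) = gh"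
      using C(6) by (auto simp: PiE_iff extensional_def fun_eq_iff)
    show "(\<lambda>f. (restrict f C, restrict f L)) ` homs (star_forest V p) H
        \<subseteq> Sigma (C \<rightarrow>\<^sub>E pverts H) (\<lambda>g. PiE L (\<lambda>v. N (g (p v))))"
      using C(4) memV by (auto simp: arcs PiE_iff)
    show "(\<lambda>(g, h) v. if v \<in> C then g v else h v) ` Sigma (C \<rightarrow>\<^sub>E pverts H) (\<lambda>g. PiE L (\<lambda>v. N (g (p v))))
        \<subseteq> homs (star_forest V p) H"
      using C(4,6) memV N by (fastforce simp: arcs PiE_iff extensional_def)
  qed
  then have "hom (star_forest V p) H = card (Sigma (C \<rightarrow>\<^sub>E pverts H) (\<lambda>g. PiE L (\<lambda>v. N (g (p v)))))"
    unfolding hom_def by (rule bij_betw_same_card)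
  also have "\<dots> = (\<Sum>g\<in>C \<rightarrow>\<^sub>E pverts H. \<Prod>v\<in>L. deg H (g (p v)))"
    using C finH N by (subst card_SigmaI) (auto intro!: finite_PiE simp: card_PiE N_def deg_eq_card_Image)
  also have "\<dots> = (\<Sum>g\<in>C \<rightarrow>\<^sub>E pverts H. \<Prod>c\<in>C. deg H (g c) ^ card (leaves V p c))"
  proof (rule sum.cong[OF refl])
    fix g
    have "(\<Prod>v\<in>L. deg H (g (p v))) = (\<Prod>c\<in>C. \<Prod>v\<in>{v\<in>L. p v = c}. deg H (g (p v)))"
      using C by (intro prod.group[symmetric]) auto
    also have "\<dots> = (\<Prod>c\<in>C. \<Prod>v\<in>leaves V p c. deg H (g c))"
      using leaves_eq[OF p] by (intro prod.cong) (auto simp: C_def L_def)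
    finally show "(\<Prod>v\<in>L. deg H (g (p v))) = (\<Prod>c\<in>C. deg H (g c) ^ card (leaves V p c))"
      by simp
  qed
  also have "\<dots> = (\<Prod>c\<in>C. \<Sum>x\<in>pverts H. deg H x ^ card (leaves V p c))"
    using C(1) finH by (subst prod_sum_PiE) auto
  finally show ?thesis
    by (simp add: power_sum_def C_def)
qed

section \<open>Isomorphism of star forests\<close>

text \<open>Bijections between corresponding fibres are glued along the index. This serves twice: to
  match centres by star size, and leaves by centre.\<close>

lemma bij_betw_of_card_fibres:
  assumes fin: "finite A" "finite B" and im: "f ` A \<subseteq> I" "g ` B \<subseteq> I"
    and card: "\<And>i. i \<in> I \<Longrightarrow> card {a \<in> A. f a = i} = card {b \<in> B. g b = i}"
  obtains \<tau> where "bij_betw \<tau> A B" "\<And>a. a \<in> A \<Longrightarrow> g (\<tau> a) = f a"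
proof -
  have "\<forall>i\<in>I. \<exists>\<tau>. bij_betw \<tau> {a \<in> A. f a = i} {b \<in> B. g b = i}"
    using fin card by (auto intro!: finite_same_card_bij)
  then obtain \<tau> where \<tau>: "\<And>i. i \<in> I \<Longrightarrow> bij_betw (\<tau> i) {a \<in> A. f a = i} {b \<in> B. g b = i}"
    by metis
  have fib: "\<tau> (f a) a \<in> B \<and> g (\<tau> (f a) a) = f a" if "a \<in> A" for a
    using bij_betwE[OF \<tau>[of "f a"]] that im by auto
  have "inj_on (\<lambda>a. \<tau> (f a) a) A"
  proof (rule inj_onI)
    fix a a' assume a: "a \<in> A" "a' \<in> A" "\<tau> (f a) a = \<tau> (f a') a'"
    then have "f a = f a'"
      using fib by metis
    then show "a = a'"
      using a \<tau>[of "f a"] im by (auto simp: bij_betw_def inj_on_def)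
  qed
  moreover have "b \<in> (\<lambda>a. \<tau> (f a) a) ` A" if "b \<in> B" for b
  proof -
    have "\<tau> (g b) ` {a \<in> A. f a = g b} = {b' \<in> B. g b' = g b}"
      using that im by (intro bij_betw_imp_surj_on \<tau>) auto
    then have "b \<in> \<tau> (g b) ` {a \<in> A. f a = g b}"
      using that by simp
    then obtain a where "a \<in> A" "f a = g b" "b = \<tau> (g b) a"
      by auto
    then show ?thesis
      by (intro image_eqI[of _ _ a]) auto
  qed
  ultimately have "bij_betw (\<lambda>a. \<tau> (f a) a) A B"
    using fib by (auto simp: bij_betw_def)
  then show ?thesis
    using fib that by blast
qed

text \<open>The multiplicity of each star size; as a function of \<open>k\<close> it determines a
  star forest up to isomorphism.\<close>

definition star_count :: "'a set \<Rightarrow> ('a \<Rightarrow> 'a) \<Rightarrow> nat \<Rightarrow> nat" where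
  "star_count V p k = card {c \<in> centres V p. card (leaves V p c) = k}"

text \<open>Centres are matched by star size, then leaves over matched centres. The glued map
  intertwines \<open>p\<close> and \<open>q\<close>, hence carries arcs to arcs.\<close>

lemma star_forest_iso:
  assumes p: "star_map V p" and q: "star_map W q" and count: "star_count V p = star_count W q"
  shows "graph_iso (star_forest V p) (star_forest W q)"
proof -
  let ?C = "centres V p" and ?D = "centres W q"
  have fin: "finite V" "finite W" "finite ?C" "finite ?D" "?C \<subseteq> V" "?D \<subseteq> W"
    using p q by (auto simp: star_map_def centres_def)
  have "card {c \<in> ?C. card (leaves V p c) = k} = card {d \<in> ?D. card (leaves W q d) = k}" for k
    using count by (simp add: star_count_def fun_eq_iff)
  then obtain \<sigma> where \<sigma>: "bij_betw \<sigma> ?C ?D"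
    and \<sigma>_card: "\<And>c. c \<in> ?C \<Longrightarrow> card (leaves W q (\<sigma> c)) = card (leaves V p c)"
    by (rule bij_betw_of_card_fibres[OF fin(3,4) subset_UNIV subset_UNIV]) blast
  have "card {v \<in> V - ?C. \<sigma> (p v) = d} = card {w \<in> W - ?D. q w = d}" if d: "d \<in> ?D" for d
  proof -
    obtain c where c: "c \<in> ?C" "d = \<sigma> c"
      using d unfolding bij_betw_imp_surj_on[OF \<sigma>, symmetric] by blast
    have "{v \<in> V - ?C. \<sigma> (p v) = d} = leaves V p c"
      using c \<sigma> star_mapD(4)[OF p] by (auto simp: leaves_eq[OF p] bij_betw_def inj_on_def)
    then show ?thesis
      using \<sigma>_card[OF c(1)] leaves_eq[OF q d] c by simp
  qed
  moreover have "(\<lambda>v. \<sigma> (p v)) ` (V - ?C) \<subseteq> ?D" "q ` (W - ?D) \<subseteq> ?D"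
    using star_mapD(4)[OF p] star_mapD(4)[OF q] bij_betwE[OF \<sigma>] by auto
  ultimately obtain \<tau> where \<tau>: "bij_betw \<tau> (V - ?C) (W - ?D)"
    and q\<tau>: "\<And>v. v \<in> V - ?C \<Longrightarrow> q (\<tau> v) = \<sigma> (p v)"
    using bij_betw_of_card_fibres[of "V - ?C" "W - ?D" "\<lambda>v. \<sigma> (p v)" ?D q] fin(1,2) by blast
  define \<phi> where "\<phi> v = (if v \<in> ?C then \<sigma> v else \<tau> v)" for v
  have "bij_betw \<phi> ?C ?D"
    using \<sigma> by (simp add: \<phi>_def cong: bij_betw_cong)
  moreover have "bij_betw \<phi> (V - ?C) (W - ?D)"
    using \<tau> by (subst bij_betw_cong[where g = \<tau>]) (auto simp: \<phi>_def)
  ultimately have "bij_betw \<phi> (?C \<union> (V - ?C)) (?D \<union> (W - ?D))"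
    by (rule bij_betw_combine) auto
  then have "bij_betw \<phi> V W"
    using fin by (simp add: Un_absorb1 Un_Diff_cancel)
  moreover have "parcs (star_forest W q) = map_prod \<phi> \<phi> ` parcs (star_forest V p)"
  proof -
    have "W - ?D = \<tau> ` (V - ?C)"
      using \<tau> by (simp add: bij_betw_def)
    moreover have "\<phi> v = \<tau> v" "\<phi> (p v) = q (\<tau> v)" if "v \<in> V - ?C" for v
      using that q\<tau> star_mapD(4)[OF p] by (auto simp: \<phi>_def)
    ultimately show ?thesis
      unfolding parcs_star_forest image_Un by (auto simp: image_image)
  qed
  ultimately show ?thesis
    unfolding graph_iso_iff using star_mapD(2)[OF p] by (auto intro!: wf_star_forest simp del: star_forest_simps(2))
qed

section \<open>Power sums of the degrees of the target\<close>

text \<open>The weak tangent bound at \<open>x / 2\<close> is squared;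
  \<open>(1 + x / 2)\<^sup>2\<close> exceeds \<open>1 + x\<close> by \<open>x\<^sup>2 / 4\<close>,
  which gives strictness.\<close>

lemma exp_gt_add_one_self:
  fixes x :: real
  assumes "x \<noteq> 0"
  shows "1 + x < exp x"
proof (cases "1 + x / 2 \<ge> 0")
  case True
  have "1 + x < (1 + x / 2)\<^sup>2"
    using assms by (auto simp: power2_eq_square algebra_simps zero_less_mult_iff)
  also have "\<dots> \<le> (exp (x / 2))\<^sup>2"
    using True exp_ge_add_one_self by (intro power_mono)
  finally show ?thesis
    by (simp add: power2_eq_square flip: exp_add)
next
  case False
  then have "1 + x < 0"
    by simp
  also have "0 < exp x"
    by simp
  finally show ?thesis .
qed

text \<open>This is the weighted arithmetic-geometric mean inequality for \<open>1\<close> and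
  \<open>t ^ m\<close>. With \<open>t = exp a\<close>, factoring out \<open>t ^ j\<close> leaves two
  exponentials, and the linear terms of their tangent bounds at 0 cancel.\<close>

lemma weighted_power_le:
  fixes t :: real
  assumes "t > 0" "j \<le> m"
  shows "real m * t ^ j \<le> real (m - j) + real j * t ^ m"
    and "0 < j \<Longrightarrow> j < m \<Longrightarrow> t \<noteq> 1 \<Longrightarrow> real m * t ^ j < real (m - j) + real j * t ^ m"
proof -
  define a where "a = ln t"
  have pow: "t ^ i = exp (real i * a)" for i
    using assms(1) by (simp add: a_def exp_of_nat_mult)
  have split: "real (m - j) + real j * t ^ m
      = exp (real j * a) * (real (m - j) * exp (- (real j * a)) + real j * exp (real (m - j) * a))"
    using assms(2) by (simp add: pow algebra_simps of_nat_diff flip: exp_add)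
  have tangent: "real m = real (m - j) * (1 - real j * a) + real j * (1 + real (m - j) * a)"
    using assms(2) by (simp add: algebra_simps of_nat_diff)
  have le1: "1 - real j * a \<le> exp (- (real j * a))" and le2: "1 + real (m - j) * a \<le> exp (real (m - j) * a)"
    using exp_ge_add_one_self[of "- (real j * a)"] exp_ge_add_one_self[of "real (m - j) * a"] by auto
  have "real m \<le> real (m - j) * exp (- (real j * a)) + real j * exp (real (m - j) * a)"
    unfolding tangent by (intro add_mono mult_left_mono le1 le2) auto
  then show "real m * t ^ j \<le> real (m - j) + real j * t ^ m"
    unfolding split by (simp add: pow mult.commute)
  assume j: "0 < j" "j < m" and "t \<noteq> 1"
  then have "real (m - j) * a \<noteq> 0"
    using assms(1) by (simp add: a_def)
  then have "1 + real (m - j) * a < exp (real (m - j) * a)"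
    by (rule exp_gt_add_one_self)
  then have "real m < real (m - j) * exp (- (real j * a)) + real j * exp (real (m - j) * a)"
    unfolding tangent using j by (intro add_le_less_mono mult_left_mono mult_strict_left_mono le1) auto
  then show "real m * t ^ j < real (m - j) + real j * t ^ m"
    unfolding split by (simp add: pow mult.commute)
qed

section \<open>Degrees in a target graph without isolated vertices\<close>

locale target_graph =
  fixes H :: "'b pair_pre_digraph"
  assumes H: "pair_pseudo_graph H" "pverts H \<noteq> {}" "\<not> (\<exists>v. isolated H v)"
begin

lemma
  shows finite_H: "finite (pverts H)"
    and sym_H: "(x, y) \<in> parcs H \<Longrightarrow> (y, x) \<in> parcs H"
    and arcs_H: "(x, y) \<in> parcs H \<Longrightarrow> x \<in> pverts H \<and> y \<in> pverts H"
proof -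
  interpret pair_pseudo_graph H by (rule H)
  show "finite (pverts H)"
    by (rule pair_finite_verts)
  show "(x, y) \<in> parcs H \<Longrightarrow> (y, x) \<in> parcs H"
    using pair_sym_arcs unfolding symmetric_def by (auto dest: symD)
  show "(x, y) \<in> parcs H \<Longrightarrow> x \<in> pverts H \<and> y \<in> pverts H"
    by (auto dest: in_arcsD1 in_arcsD2)
qed

lemma Image_subset: "parcs H `` {x} \<subseteq> pverts H" "finite (parcs H `` {x})"
proof -
  show "parcs H `` {x} \<subseteq> pverts H"
    using arcs_H by auto
  then show "finite (parcs H `` {x})"
    using finite_H by (rule finite_subset)
qed

lemma ex_neighbour: "x \<in> pverts H \<Longrightarrow> \<exists>y. (x, y) \<in> parcs H"
  using H(3) sym_H unfolding isolated_def by (metis prod.collapse)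

lemma deg_pos: "x \<in> pverts H \<Longrightarrow> deg H x > 0"
  using ex_neighbour[of x] Image_subset(2)[of x] by (auto simp: deg_eq_card_Image card_gt_0_iff)

lemma deg_le_max_deg: "x \<in> pverts H \<Longrightarrow> deg H x \<le> max_deg H"
  unfolding max_deg_def using finite_H by (intro Max_ge) auto

lemma max_deg_attained: obtains x where "x \<in> pverts H" "deg H x = max_deg H"
proof -
  have "max_deg H \<in> deg H ` pverts H"
    unfolding max_deg_def using finite_H H(2) by (intro Max_in) auto
  then show ?thesis
    using that by auto
qed

lemma complete_if_all_degrees:
  assumes "\<forall>x\<in>pverts H. card (pverts H) \<le> deg H x"
  shows "parcs H = pverts H \<times> pverts H"
proof -
  have "parcs H `` {x} = pverts H" if "x \<in> pverts H" for x
    using assms that Image_subset(1) finite_H by (intro card_seteq) (auto simp: deg_eq_card_Image)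
  then show ?thesis
    using arcs_H by auto
qed

text \<open>Otherwise \<open>card (pverts H) * M = S\<^sub>1 \<le> M\<^sup>2\<close> would make every degree equal to \<open>card (pverts H)\<close>.\<close>

lemma ex_degree_neq:
  fixes M :: real
  assumes "parcs H \<noteq> pverts H \<times> pverts H" "M > 0" "real (power_sum H 1) \<le> M\<^sup>2"
  shows "\<exists>x\<in>pverts H. real (deg H x) \<noteq> M"
proof (rule ccontr)
  assume "\<not> ?thesis"
  then have all: "\<forall>x\<in>pverts H. real (deg H x) = M"
    by auto
  then have "real (power_sum H 1) = real (card (pverts H)) * M"
    by (simp add: power_sum_def)
  then have "real (card (pverts H)) \<le> M"
    using assms(2,3) by (simp add: power2_eq_square)
  then have "\<forall>x\<in>pverts H. card (pverts H) \<le> deg H x"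
    using all by (metis of_nat_le_iff)
  then show False
    using complete_if_all_degrees assms(1) by blast
qed

text \<open>After scaling the degrees by \<open>M\<close>, the assumptions bound the sums of
  \<open>t\<close> and of \<open>t ^ D\<close> by \<open>M\<close>. The mean inequality at each
  vertex does the same for \<open>t ^ k\<close>, strictly as soon as some \<open>t x\<close> differs
  from 1, which \<open>ex_degree_neq\<close> provides.\<close>

lemma power_sum_interpolate:
  fixes M :: real
  assumes M: "M > 0" "real (power_sum H 1) \<le> M\<^sup>2" "real (power_sum H D) \<le> M ^ (D + 1)"
    and k: "1 < k" "k < D"
  shows "real (power_sum H k) \<le> M ^ (k + 1)"
    and "parcs H \<noteq> pverts H \<times> pverts H \<Longrightarrow> real (power_sum H k) < M ^ (k + 1)"
proof -
  define t where "t x = real (deg H x) / M" for x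
  have t: "t x > 0" if "x \<in> pverts H" for x
    using deg_pos[OF that] M(1) by (simp add: t_def)
  have S: "real (power_sum H i) = M ^ i * (\<Sum>x\<in>pverts H. t x ^ i)" for i
    using M(1) by (simp add: power_sum_def t_def power_divide flip: sum_divide_distrib)
  have "(\<Sum>x\<in>pverts H. t x ^ 1) \<le> M" "(\<Sum>x\<in>pverts H. t x ^ D) \<le> M"
    using M unfolding S by (simp_all add: power2_eq_square)
  moreover define f where "f x = real (D - k) * t x ^ 1 + real (k - 1) * t x ^ D" for x
  moreover have "(\<Sum>x\<in>pverts H. f x)
      = real (D - k) * (\<Sum>x\<in>pverts H. t x ^ 1) + real (k - 1) * (\<Sum>x\<in>pverts H. t x ^ D)"
    by (simp add: f_def sum.distrib sum_distrib_left)
  ultimately have "(\<Sum>x\<in>pverts H. f x) \<le> real (D - k) * M + real (k - 1) * M"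
    by (simp add: add_mono mult_left_mono)
  also have "\<dots> = real (D - 1) * M"
    using k by (simp add: of_nat_diff algebra_simps)
  finally have f_sum: "(\<Sum>x\<in>pverts H. f x) \<le> real (D - 1) * M" .
  \<comment> \<open>\<open>weighted_power_le\<close> compares the exponents \<open>0\<close>,
    \<open>j\<close>, \<open>m\<close>; splitting off one factor \<open>t x\<close> shifts
    \<open>1\<close>, \<open>k\<close>, \<open>D\<close> to \<open>0\<close>, \<open>k - 1\<close>,
    \<open>D - 1\<close>.\<close>
  have "t x ^ k = t x * t x ^ (k - 1)" "t x ^ D = t x * t x ^ (D - 1)" for x
    using k by (simp_all flip: power_Suc)
  then have f_eq: "f x = t x * (real (D - 1 - (k - 1)) + real (k - 1) * t x ^ (D - 1))"
    and t_eq: "real (D - 1) * t x ^ k = t x * (real (D - 1) * t x ^ (k - 1))" for x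
    using k by (simp_all add: f_def algebra_simps)
  have le: "real (D - 1) * t x ^ k \<le> f x" if "x \<in> pverts H" for x
    unfolding f_eq t_eq using t[OF that] weighted_power_le(1)[OF t[OF that], of "k - 1" "D - 1"] k
    by (intro mult_left_mono) auto
  have less: "real (D - 1) * t x ^ k < f x" if "x \<in> pverts H" "t x \<noteq> 1" for x
    unfolding f_eq t_eq using t[OF that(1)] weighted_power_le(2)[OF t[OF that(1)], of "k - 1" "D - 1"] k that
    by (intro mult_strict_left_mono) auto
  have D: "real (D - 1) > 0"
    using k by simp
  have "real (D - 1) * (\<Sum>x\<in>pverts H. t x ^ k) \<le> (\<Sum>x\<in>pverts H. f x)"
    unfolding sum_distrib_left by (intro sum_mono le)
  then have "(\<Sum>x\<in>pverts H. t x ^ k) \<le> M"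
    using f_sum D by (meson mult_le_cancel_left_pos order_trans)
  then show "real (power_sum H k) \<le> M ^ (k + 1)"
    unfolding S using M(1) by (simp add: mult.commute)
  assume "parcs H \<noteq> pverts H \<times> pverts H"
  then obtain x where "x \<in> pverts H" "t x \<noteq> 1"
    using ex_degree_neq[OF _ M(1,2)] M(1) by (auto simp: t_def)
  then have "real (D - 1) * (\<Sum>x\<in>pverts H. t x ^ k) < (\<Sum>x\<in>pverts H. f x)"
    unfolding sum_distrib_left using finite_H le less by (intro sum_strict_mono_ex1) auto
  then have "(\<Sum>x\<in>pverts H. t x ^ k) < M"
    using f_sum D by (meson mult_less_cancel_left_pos order_less_le_trans)
  then show "real (power_sum H k) < M ^ (k + 1)"
    unfolding S using M(1) by (simp add: mult.commute)
qed

text \<open>All degrees are at most the square root \<open>M\<close> of the edge count, so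
  \<open>k - 1\<close> factors of each \<open>deg H x ^ k\<close> can be replaced by
  \<open>M\<close>, leaving \<open>M\<^sup>2 * M ^ (k - 1)\<close>. A vertex of degree below
  \<open>M\<close> makes this strict.\<close>

lemma power_sum_less_of_edges:
  assumes "parcs H \<noteq> pverts H \<times> pverts H" "(max_deg H)\<^sup>2 \<le> power_sum H 1" "k \<ge> 2"
  shows "real (power_sum H k) < sqrt (power_sum H 1) ^ (k + 1)"
proof -
  define M where "M = sqrt (power_sum H 1)"
  have M2: "M\<^sup>2 = real (power_sum H 1)"
    by (simp add: M_def)
  have le: "real (deg H x) \<le> M" if "x \<in> pverts H" for x
  proof -
    have "(deg H x)\<^sup>2 \<le> power_sum H 1"
      using assms(2) deg_le_max_deg[OF that] by (meson order_trans power_mono zero_le)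
    then show ?thesis
      unfolding M_def by (intro real_le_rsqrt) (metis of_nat_le_iff of_nat_power)
  qed
  obtain x0 where "x0 \<in> pverts H"
    using H(2) by blast
  then have "M > 0"
    using le[of x0] deg_pos[of x0] by simp
  then obtain x where x: "x \<in> pverts H" "real (deg H x) < M"
    using ex_degree_neq[OF assms(1), of M] M2 le by (metis order_le_less order_refl)
  have k: "y ^ k = y * y ^ (k - 1)" for y :: real
    using assms(3) by (simp flip: power_Suc)
  have "real (power_sum H k) = (\<Sum>x\<in>pverts H. real (deg H x) * real (deg H x) ^ (k - 1))"
    by (simp add: power_sum_def k)
  also have "\<dots> < (\<Sum>x\<in>pverts H. real (deg H x) * M ^ (k - 1))"
    using finite_H x le deg_pos assms(3)
    by (intro sum_strict_mono_ex1 ballI bexI[of _ x] mult_left_mono mult_strict_left_mono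
        power_mono power_strict_mono) auto
  also have "\<dots> = M ^ 2 * M ^ (k - 1)"
    unfolding M2 by (simp add: power_sum_def sum_distrib_right)
  also have "\<dots> = M ^ (k + 1)"
    using assms(3) by (simp flip: power_add)
  finally show ?thesis
    unfolding M_def .
qed

text \<open>A single vertex of maximum degree already contributes \<open>\<Delta> ^ k\<close>, and
  since \<open>\<Delta>\<close> exceeds the square root \<open>M\<close>, this outgrows
  \<open>M ^ (k + 1)\<close>.\<close>

lemma ex_star_beats:
  assumes "power_sum H 1 < (max_deg H)\<^sup>2"
  shows "\<exists>k\<ge>2. sqrt (power_sum H 1) ^ (k + 1) < real (power_sum H k)"
proof -
  define M where "M = sqrt (power_sum H 1)"
  define \<Delta> where "\<Delta> = real (max_deg H)"
  obtain x where x: "x \<in> pverts H" "deg H x = max_deg H"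
    by (rule max_deg_attained)
  have S: "\<Delta> ^ k \<le> real (power_sum H k)" for k
    using member_le_sum[of x "pverts H" "\<lambda>x. deg H x ^ k"] x finite_H
    unfolding power_sum_def \<Delta>_def by (metis bot_nat_0.extremum of_nat_le_iff of_nat_power)
  have "\<Delta> > 0"
    using x deg_pos[OF x(1)] by (simp add: \<Delta>_def)
  then have "M > 0"
    using S[of 1] unfolding M_def by simp
  moreover have "M < \<Delta>"
    unfolding M_def \<Delta>_def using assms by (intro real_less_lsqrt) (auto simp flip: of_nat_power)
  ultimately have r: "\<Delta> / M > 1"
    by simp
  then obtain n where "M < (\<Delta> / M) ^ n"
    using real_arch_pow by blast
  \<comment> \<open>Raising the exponent by 2 secures a star with at least two leaves.\<close>
  also have "\<dots> \<le> (\<Delta> / M) ^ (n + 2)"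
    using r by (intro power_increasing) auto
  finally have "M ^ (n + 2 + 1) < \<Delta> ^ (n + 2)"
    using \<open>M > 0\<close> by (simp add: power_divide field_simps)
  then show ?thesis
    using S[of "n + 2"] unfolding M_def by (intro exI[of _ "n + 2"]) auto
qed

text \<open>If all neighbours of each vertex were pairwise adjacent, a neighbour \<open>x\<close> of a vertex \<open>c\<close> of
  maximum degree would satisfy \<open>deg x \<ge> deg c\<close>; summing over the neighbours of \<open>c\<close> contradicts the
  assumption.\<close>

lemma ex_nonadjacent_neighbours:
  assumes "power_sum H 1 < (max_deg H)\<^sup>2"
  shows "\<exists>c x y. (c, x) \<in> parcs H \<and> (c, y) \<in> parcs H \<and> (x, y) \<notin> parcs H"
proof (rule ccontr)
  assume ex: "\<not> ?thesis"
  have adj: "(x, y) \<in> parcs H" if "(c, x) \<in> parcs H" "(c, y) \<in> parcs H" for c x y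
    using ex that by blast
  obtain c where c: "c \<in> pverts H" "deg H c = max_deg H"
    by (rule max_deg_attained)
  have "max_deg H \<le> deg H x" if "x \<in> parcs H `` {c}" for x
    unfolding c(2)[symmetric] deg_eq_card_Image using that adj Image_subset(2)
    by (intro card_mono) auto
  then have "(\<Sum>x\<in>parcs H `` {c}. max_deg H) \<le> (\<Sum>x\<in>parcs H `` {c}. deg H x)"
    by (intro sum_mono) auto
  also have "\<dots> \<le> power_sum H 1"
    unfolding power_sum_def using Image_subset(1) finite_H by (simp add: sum_mono2)
  finally show False
    using assms c(2) by (simp add: deg_eq_card_Image power2_eq_square)
qed

end

section \<open>Disjoint copies of stars\<close>

text \<open>Otherwise the literal \<open>1\<close> of \<open>K2\<close> and \<open>complete_bipartite 1 k\<close> would be rewritten to \<open>Suc 0\<close>.\<close>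

declare One_nat_def [simp del]

section \<open>Edges, stars, copies and disjoint unions as star forests\<close>

text \<open>The graphs to compare with are rewritten as star forests, so that isomorphism reduces to
  comparing \<open>star_count\<close> and \<open>hom\<close> becomes a product of power
  sums.\<close>

lemma star_forest_K2: "K2 = star_forest {0, 1} (\<lambda>_. 0)"
  by (auto simp: K2_def star_forest_def)

lemma star_forest_complete_bipartite:
  "complete_bipartite 1 k = star_forest ({..<1} <+> {..<k}) (\<lambda>_. Inl 0)"
  by (auto simp: complete_bipartite_def star_forest_def)

lemma star_forest_copies:
  "copies m (star_forest V p) = star_forest ({..<m} \<times> V) (map_prod id p)"
  by (auto simp: copies_def star_forest_def)

lemma star_forest_disjoint_union:
  "disjoint_union (star_forest V p) (star_forest W q) = star_forest (V <+> W) (map_sum p q)"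
  by (auto simp: disjoint_union_def star_forest_def)

lemma star_map_K2: "star_map {0, 1::nat} (\<lambda>_. 0)"
  by (auto simp: star_map_def)

lemma star_map_complete_bipartite:
  "k \<ge> 1 \<Longrightarrow> star_map ({..<1::nat} <+> {..<k::nat}) (\<lambda>_. Inl 0)"
  by (auto simp: star_map_def intro!: bexI[of _ "Inr 0"])

lemma star_map_copies:
  assumes "star_map V p"
  shows "star_map ({..<m::nat} \<times> V) (map_prod id p)"
proof -
  have "\<exists>w\<in>{..<m} \<times> V. w \<noteq> (i, c) \<and> map_prod id p w = (i, c)"
    if i: "i < m" and c: "c \<in> V" "p c = c" for i c
  proof -
    obtain v where "v \<in> V" "v \<noteq> c" "p v = c"
      using assms c unfolding star_map_def by blast
    then show ?thesis
      using i by (intro bexI[of _ "(i, v)"]) auto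
  qed
  then show ?thesis
    using assms by (auto simp: star_map_def)
qed

lemma star_map_disjoint_union:
  assumes p: "star_map V p" and q: "star_map W q"
  shows "star_map (V <+> W) (map_sum p q)"
proof -
  have "\<exists>w\<in>V <+> W. w \<noteq> Inl c \<and> map_sum p q w = Inl c" if c: "c \<in> V" "p c = c" for c
  proof -
    obtain v where "v \<in> V" "v \<noteq> c" "p v = c"
      using p c unfolding star_map_def by blast
    then show ?thesis
      by (intro bexI[of _ "Inl v"]) auto
  qed
  moreover have "\<exists>w\<in>V <+> W. w \<noteq> Inr c \<and> map_sum p q w = Inr c" if c: "c \<in> W" "q c = c" for c
  proof -
    obtain v where "v \<in> W" "v \<noteq> c" "q v = c"
      using q c unfolding star_map_def by blast
    then show ?thesis
      by (intro bexI[of _ "Inr v"]) auto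
  qed
  ultimately show ?thesis
    using p q by (auto simp: star_map_def)
qed

lemma centres_K2: "centres {0, 1::nat} (\<lambda>_. 0) = {0}" "leaves {0, 1::nat} (\<lambda>_. 0) 0 = {1}"
  by (auto simp: centres_def leaves_def)

lemma centres_complete_bipartite:
  "centres ({..<1::nat} <+> {..<k::nat}) (\<lambda>_. Inl 0) = {Inl 0}"
  "leaves ({..<1::nat} <+> {..<k::nat}) (\<lambda>_. Inl 0) (Inl 0) = Inr ` {..<k}"
  by (auto simp: centres_def leaves_def)

lemma centres_copies:
  "centres ({..<m::nat} \<times> V) (map_prod id p) = {..<m} \<times> centres V p"
  "i < m \<Longrightarrow> leaves ({..<m::nat} \<times> V) (map_prod id p) (i, c) = Pair i ` leaves V p c"
  by (auto simp: centres_def leaves_def)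

lemma centres_disjoint_union:
  "centres (V <+> W) (map_sum p q) = centres V p <+> centres W q"
  "leaves (V <+> W) (map_sum p q) (Inl c) = Inl ` leaves V p c"
  "leaves (V <+> W) (map_sum p q) (Inr d) = Inr ` leaves W q d"
  by (auto simp: centres_def leaves_def)

lemma star_count_uniform:
  assumes "\<forall>c\<in>centres V p. card (leaves V p c) = k"
  shows "star_count V p j = card (centres V p) * of_bool (j = k)"
proof -
  have "{c \<in> centres V p. card (leaves V p c) = j} = (if j = k then centres V p else {})"
    using assms by auto
  then show ?thesis
    by (simp add: star_count_def)
qed

lemma star_count_K2: "star_count {0, 1::nat} (\<lambda>_. 0) j = of_bool (j = 1)"
  by (subst star_count_uniform[where k = 1]) (simp_all add: centres_K2)

lemma star_count_complete_bipartite: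
  "star_count ({..<1::nat} <+> {..<k::nat}) (\<lambda>_. Inl 0) j = of_bool (j = k)"
  by (subst star_count_uniform[where k = k]) (simp_all add: centres_complete_bipartite card_image)

lemma star_count_copies: "star_count ({..<m} \<times> V) (map_prod id p) j = m * star_count V p j"
proof -
  have "{c \<in> {..<m} \<times> centres V p. card (leaves ({..<m} \<times> V) (map_prod id p) c) = j}
      = {..<m} \<times> {c \<in> centres V p. card (leaves V p c) = j}"
    by (auto simp: centres_copies card_image inj_on_def)
  then show ?thesis
    by (simp add: star_count_def centres_copies card_cartesian_product)
qed

lemma star_count_disjoint_union:
  assumes "finite V" "finite W"
  shows "star_count (V <+> W) (map_sum p q) j = star_count V p j + star_count W q j"
proof -
  have "{c \<in> centres V p <+> centres W q. card (leaves (V <+> W) (map_sum p q) c) = j}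
      = {c \<in> centres V p. card (leaves V p c) = j} <+> {c \<in> centres W q. card (leaves W q c) = j}"
    by (auto simp: centres_disjoint_union card_image)
  then show ?thesis
    using assms unfolding star_count_def centres_disjoint_union(1)
    by (simp add: card_Plus centres_def)
qed

section \<open>Homomorphism counts of edges, stars and their copies\<close>

lemma hom_K2: "pair_pseudo_graph H \<Longrightarrow> hom K2 H = power_sum H 1"
  by (simp only: star_forest_K2 hom_star_forest[OF star_map_K2] centres_K2,
    simp add: centres_K2(2), simp add: One_nat_def)

lemma hom_complete_bipartite:
  "pair_pseudo_graph H \<Longrightarrow> k \<ge> 1 \<Longrightarrow> hom (complete_bipartite 1 k) H = power_sum H k"
  by (simp only: star_forest_complete_bipartite hom_star_forest[OF star_map_complete_bipartite]
      centres_complete_bipartite) (simp add: centres_complete_bipartite card_image)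

lemma hom_copies_star_forest:
  assumes "star_map V p" "pair_pseudo_graph H"
  shows "hom (copies m (star_forest V p)) H = hom (star_forest V p) H ^ m"
proof -
  have "(\<Prod>c\<in>{..<m} \<times> centres V p. power_sum H (card (leaves ({..<m} \<times> V) (map_prod id p) c)))
      = (\<Prod>c\<in>{..<m} \<times> centres V p. power_sum H (card (leaves V p (snd c))))"
    by (intro prod.cong) (auto simp: centres_copies card_image inj_on_def)
  also have "\<dots> = (\<Prod>i<m. \<Prod>c\<in>centres V p. power_sum H (card (leaves V p c)))"
    by (subst prod.cartesian_product) (simp add: split_def)
  finally show ?thesis
    by (simp add: star_forest_copies hom_star_forest[OF star_map_copies] hom_star_forest assms centres_copies
        del: star_forest_simps)
qed

lemma hom_is_copies_of_K2:
  assumes "is_copies_of G K2" "pair_pseudo_graph H"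
  shows "\<exists>m. card (pverts G) = m * 2 \<and> hom G H = power_sum H 1 ^ m"
proof -
  define m where "m = card (pverts G) div 2"
  have "card (pverts K2) = 2"
    by (simp add: K2_def)
  then have "card (pverts G) = m * 2" "hom G H = hom (copies m K2) H"
    using assms(1) hom_graph_iso unfolding is_copies_of_def m_def
    by (metis dvd_div_mult_self)+
  then show ?thesis
    using hom_copies_star_forest[OF star_map_K2 assms(2), of m] hom_K2[OF assms(2)]
    unfolding star_forest_K2[symmetric] by auto
qed

lemma hom_is_copies_of_complete_bipartite:
  assumes "is_copies_of G (complete_bipartite 1 k)" "pair_pseudo_graph H" "k \<ge> 1"
  shows "\<exists>m. card (pverts G) = m * (k + 1) \<and> hom G H = power_sum H k ^ m"
proof -
  define m where "m = card (pverts G) div (k + 1)"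
  have "card (pverts (complete_bipartite 1 k)) = k + 1"
    by (simp add: complete_bipartite_def card_Plus)
  then have "card (pverts G) = m * (k + 1)" "hom G H = hom (copies m (complete_bipartite 1 k)) H"
    using assms(1) hom_graph_iso unfolding is_copies_of_def m_def
    by (metis dvd_div_mult_self)+
  then show ?thesis
    using hom_copies_star_forest[OF star_map_complete_bipartite[OF assms(3)] assms(2), of m]
      hom_complete_bipartite[OF assms(2,3)]
    unfolding star_forest_complete_bipartite[symmetric] by auto
qed

section \<open>Recognising copies by their star sizes\<close>

text \<open>By \<open>count\<close>, \<open>star_forest W q\<close> is a single star with
  \<open>k\<close> leaves. Both forests then have equal star counts once one copy is taken for each
  centre of \<open>p\<close>.\<close>

lemma uniform_star_forest_is_copies_of:
  assumes p: "star_map V p" and k: "\<forall>c\<in>centres V p. card (leaves V p c) = k"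
    and q: "star_map W q" and count: "star_count W q = (\<lambda>j. of_bool (j = k))" and card: "card W = k + 1"
  shows "is_copies_of (star_forest V p) (star_forest W q)"
proof -
  let ?m = "card (centres V p)"
  have n: "card V = ?m * (k + 1)"
    using card_star_map[OF p] k by simp
  have "graph_iso (star_forest V p) (star_forest ({..<?m} \<times> W) (map_prod id q))"
    by (intro star_forest_iso p star_map_copies q ext)
      (simp add: star_count_copies count star_count_uniform[OF k])
  moreover have "card V div (k + 1) = ?m"
    unfolding n by (rule nonzero_mult_div_cancel_right) simp
  ultimately show ?thesis
    using dvd_triv_right[of "k + 1" ?m] unfolding is_copies_of_def star_forest_copies star_forest_simps(1) card
    by (simp only: n)
qed

lemma is_copies_of_K2:
  assumes "star_map V p" "\<forall>c\<in>centres V p. card (leaves V p c) = 1"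
  shows "is_copies_of (star_forest V p) K2"
  unfolding star_forest_K2
  by (rule uniform_star_forest_is_copies_of[OF assms star_map_K2]) (auto simp: star_count_K2 fun_eq_iff)

lemma is_copies_of_complete_bipartite:
  assumes "star_map V p" "\<forall>c\<in>centres V p. card (leaves V p c) = k" "k \<ge> 1"
  shows "is_copies_of (star_forest V p) (complete_bipartite 1 k)"
  unfolding star_forest_complete_bipartite
  by (rule uniform_star_forest_is_copies_of[OF assms(1,2) star_map_complete_bipartite[OF assms(3)]])
    (auto simp: star_count_complete_bipartite fun_eq_iff card_Plus)

lemma two_size_star_forest_iso:
  assumes p: "star_map V p" and k: "\<forall>c\<in>centres V p. card (leaves V p c) \<in> {1, k}" "k \<ge> 1"
  shows "\<exists>a b. graph_iso (star_forest V p)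
    (disjoint_union (copies a K2) (copies b (complete_bipartite 1 k)))"
proof -
  \<comment> \<open>For \<open>k = 1\<close> the two kinds of component coincide; setting
    \<open>b\<close> to 0 avoids counting them twice.\<close>
  define a b where "a = star_count V p 1" and "b = (if k = 1 then 0 else star_count V p k)"
  have "star_count V p j = a * of_bool (j = 1) + b * of_bool (j = k)" for j
  proof (cases "j \<in> {1, k}")
    case False
    then have none: "{c \<in> centres V p. card (leaves V p c) = j} = {}"
      using k by auto
    then show ?thesis
      using False unfolding star_count_def none by simp
  qed (auto simp: a_def b_def)
  then have "star_count V p = star_count (({..<a} \<times> {0, 1::nat}) <+> ({..<b} \<times> ({..<1::nat} <+> {..<k})))
      (map_sum (map_prod id (\<lambda>_. 0)) (map_prod id (\<lambda>_. Inl 0)))"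
    by (intro ext) (subst star_count_disjoint_union;
        simp add: star_count_copies star_count_K2 star_count_complete_bipartite finite_Plus)
  then have "graph_iso (star_forest V p)
      (disjoint_union (copies a K2) (copies b (complete_bipartite 1 k)))"
    unfolding star_forest_K2 star_forest_complete_bipartite star_forest_copies star_forest_disjoint_union
    by (intro star_forest_iso p star_map_disjoint_union star_map_copies star_map_K2
        star_map_complete_bipartite k(2))
  then show ?thesis
    by blast
qed

section \<open>Graphs attaining the bound\<close>

text \<open>One strictly smaller factor would make the whole product smaller, as the remaining
  factors are positive. This passes equality in the bound down to each star.\<close>

lemma prod_eq_imp_eq:
  fixes f g :: "'a \<Rightarrow> real"
  assumes "finite A" "\<And>a. a \<in> A \<Longrightarrow> 0 < f a \<and> f a \<le> g a" "prod f A = prod g A" "a \<in> A"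
  shows "f a = g a"
proof (rule ccontr)
  assume "f a \<noteq> g a"
  then have less: "f a < g a" "0 < g a"
    using assms(2)[OF assms(4)] by auto
  have "0 < prod f (A - {a})"
    using assms(2) by (intro prod_pos) auto
  then have "f a * prod f (A - {a}) < g a * prod f (A - {a})"
    using less(1) by (intro mult_strict_right_mono)
  also have "\<dots> \<le> g a * prod g (A - {a})"
    using less(2) assms(2) by (intro mult_left_mono prod_mono) (auto simp: less_imp_le)
  finally show False
    using assms(1,3,4) by (simp add: prod.remove)
qed

context target_graph
begin

section \<open>Contribution of a star per vertex\<close>

text \<open>A star with \<open>k\<close> leaves has \<open>k + 1\<close> vertices, so this is the
  geometric mean contribution of one of its vertices. It makes stars of different sizes
  comparable.\<close>

definition rate :: "nat \<Rightarrow> real" where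
  "rate k = real (power_sum H k) powr (1 / real (k + 1))"

lemma power_sum_pos: "power_sum H k > 0"
  unfolding power_sum_def using finite_H H(2) deg_pos by (intro sum_pos) auto

lemma rate_pos: "rate k > 0"
  using power_sum_pos[of k] by (simp add: rate_def)

text \<open>The real exponents in \<open>hom_bound\<close> and \<open>star_beats_edges\<close> have
  this shape and so become natural powers of rates.\<close>

lemma rate_powr: "real (power_sum H k) powr (real m / real (k + 1)) = rate k ^ m"
proof -
  have "rate k ^ m = rate k powr real m"
    by (simp add: powr_realpow rate_pos)
  also have "\<dots> = real (power_sum H k) powr (1 / real (k + 1) * real m)"
    unfolding rate_def by (rule powr_powr)
  also have "1 / real (k + 1) * real m = real m / real (k + 1)"
    by simp
  finally show ?thesis ..
qed

lemma power_sum_eq_rate: "real (power_sum H k) = rate k ^ (k + 1)"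
proof -
  have "real (k + 1) / real (k + 1) = 1"
    by simp
  then show ?thesis
    using rate_powr[of k "k + 1"] by (simp only: powr_one of_nat_0_le_iff)
qed

lemma rate_1: "rate 1 = sqrt (power_sum H 1)"
  by (simp add: rate_def powr_half_sqrt)

lemma power_sum_1: "real (power_sum H 1) = (rate 1)\<^sup>2"
  unfolding power_sum_eq_rate by (simp add: power2_eq_square)

text \<open>The larger of the two end rates is thus an admissible \<open>M\<close> in
  \<open>power_sum_interpolate\<close>.\<close>

lemma power_sum_le_max:
  "real (power_sum H 1) \<le> (max (rate 1) (rate D))\<^sup>2"
  "real (power_sum H D) \<le> max (rate 1) (rate D) ^ (D + 1)"
  unfolding power_sum_1 power_sum_eq_rate[of D]
  using rate_pos[of 1] rate_pos[of D] by (intro power_mono; simp)+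

lemma hom_bound_eq:
  assumes "D \<ge> 1"
  shows "hom_bound n D H = max (rate 1) (rate D) ^ n"
proof -
  have "max (rate 1 ^ n) (rate D ^ n) = max (rate 1) (rate D) ^ n"
  proof (cases "rate 1 \<le> rate D")
    case True
    then show ?thesis
      using power_mono[OF True, of n] rate_pos[of 1] by simp
  next
    case False
    then show ?thesis
      using power_mono[of "rate D" "rate 1" n] rate_pos[of D] by simp
  qed
  moreover have "real (power_sum H 1) powr (real n / 2) = rate 1 ^ n"
    using rate_powr[of 1 n] by simp
  moreover have "real (power_sum H D) powr (real n / real (1 + D)) = rate D ^ n"
    using rate_powr[of D n] by (simp only: add.commute)
  ultimately show ?thesis
    unfolding hom_bound_def hom_K2[OF H(1)] hom_complete_bipartite[OF H(1) assms] by simp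
qed

text \<open>Both sides of the comparison are squares of rates. The argument \<open>m\<close> counts
  vertices, whereas \<open>rate\<close> is indexed by leaves.\<close>

lemma star_beats_edges_iff: "star_beats_edges H m \<longleftrightarrow> m \<ge> 3 \<and> rate 1 < rate (m - 1)"
proof (cases "m \<ge> 3")
  case True
  then have "real (power_sum H (m - 1)) powr (2 / real m) = rate (m - 1) ^ 2"
    using rate_powr[of "m - 1" 2] by simp
  then have "star_beats_edges H m \<longleftrightarrow> (rate 1)\<^sup>2 < (rate (m - 1))\<^sup>2"
    using True unfolding star_beats_edges_def hom_K2[OF H(1)] power_sum_1
    by (simp add: hom_complete_bipartite[OF H(1)])
  then show ?thesis
    using True rate_pos[of 1] rate_pos[of "m - 1"] power_strict_mono[of "rate 1" "rate (m - 1)" 2]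
      power2_less_imp_less[of "rate 1" "rate (m - 1)"] by auto
qed (simp add: star_beats_edges_def)

lemma rate_le_max:
  assumes "1 \<le> k" "k \<le> D"
  shows "rate k \<le> max (rate 1) (rate D)"
proof (cases "k = 1 \<or> k = D")
  case False
  let ?M = "max (rate 1) (rate D)"
  have "?M > 0"
    using rate_pos[of 1] by simp
  then have "rate k ^ (k + 1) \<le> ?M ^ (k + 1)"
    unfolding power_sum_eq_rate[symmetric] using False assms by (intro power_sum_interpolate(1)[OF _ power_sum_le_max]) auto
  then show ?thesis
    unfolding Suc_eq_plus1[symmetric] using \<open>?M > 0\<close>
    by (intro power_le_imp_le_base[of "rate k" k ?M]) (auto simp: less_imp_le)
qed auto

lemma rate_less_max:
  assumes "1 < k" "k < D" "parcs H \<noteq> pverts H \<times> pverts H"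
  shows "rate k < max (rate 1) (rate D)"
proof -
  let ?M = "max (rate 1) (rate D)"
  have "?M > 0"
    using rate_pos[of 1] by simp
  then have "rate k ^ (k + 1) < ?M ^ (k + 1)"
    unfolding power_sum_eq_rate[symmetric] using assms by (intro power_sum_interpolate(2)[OF _ power_sum_le_max]) auto
  then show ?thesis
    by (rule power_less_imp_less_base) (simp add: less_imp_le rate_pos le_max_iff_disj)
qed

lemma rate_less_of_edges:
  assumes "parcs H \<noteq> pverts H \<times> pverts H" "(max_deg H)\<^sup>2 \<le> power_sum H 1" "k \<ge> 2"
  shows "rate k < rate 1"
proof (rule power_less_imp_less_base)
  show "rate k ^ (k + 1) < rate 1 ^ (k + 1)"
    using power_sum_less_of_edges[OF assms] unfolding power_sum_eq_rate[of k] rate_1 .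
  show "0 \<le> rate 1"
    using rate_pos[of 1] by simp
qed

lemma ex_star_beats_edges:
  assumes "power_sum H 1 < (max_deg H)\<^sup>2"
  shows "\<exists>m. star_beats_edges H m"
proof -
  obtain k where k: "k \<ge> 2" "rate 1 ^ (k + 1) < rate k ^ (k + 1)"
    using ex_star_beats[OF assms] unfolding power_sum_eq_rate[of k] rate_1[symmetric]
    by (metis power_sum_eq_rate)
  then have "rate 1 < rate k"
    by (intro power_less_imp_less_base[of "rate 1"]) (auto simp: less_imp_le rate_pos)
  then show ?thesis
    using k(1) by (intro exI[of _ "k + 1"]) (simp add: star_beats_edges_iff)
qed

section \<open>Arcs excluded by equal homomorphism sets\<close>

lemma homs_star_forestI:
  assumes "f \<in> V \<rightarrow>\<^sub>E pverts H" "\<And>w. w \<in> V \<Longrightarrow> p w \<noteq> w \<Longrightarrow> (f w, f (p w)) \<in> parcs H"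
  shows "f \<in> homs (star_forest V p) H"
  using assms sym_H by (auto simp: homs_def)

text \<open>A homomorphism of the star forest may place two vertices of different stars freely.\<close>

lemma same_star_of_homs_eq:
  assumes p: "star_map V p" and uv: "u \<in> V" "v \<in> V"
    and adj: "\<forall>f\<in>homs (star_forest V p) H. (f u, f v) \<in> parcs H"
    and H': "parcs H \<noteq> pverts H \<times> pverts H"
  shows "p u = p v"
proof (rule ccontr)
  assume neq: "p u \<noteq> p v"
  obtain x y where xy: "x \<in> pverts H" "y \<in> pverts H" "(x, y) \<notin> parcs H"
    using H' arcs_H by auto
  obtain x' y' where x': "(x, x') \<in> parcs H" and y': "(y, y') \<in> parcs H"
    using ex_neighbour xy by blast
  \<comment> \<open>The star of \<open>u\<close> is mapped onto the edge \<open>x x'\<close> so that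
    \<open>u\<close> goes to \<open>x\<close>, whether it is a centre or a leaf; all other stars go
    to \<open>y y'\<close>, oriented so that \<open>v\<close> goes to \<open>y\<close>.\<close>
  define f where "f = restrict (\<lambda>w. if p w = p u then if (p w = w) = (p u = u) then x else x'
      else if (p w = w) = (p v = v) then y else y') V"
  have "f \<in> homs (star_forest V p) H"
  proof (rule homs_star_forestI)
    show "f \<in> V \<rightarrow>\<^sub>E pverts H"
      using xy arcs_H[OF x'] arcs_H[OF y'] by (simp add: f_def PiE_iff)
    show "(f w, f (p w)) \<in> parcs H" if "w \<in> V" "p w \<noteq> w" for w
      using that star_mapD(2,3)[OF p that(1)] x' y' sym_H[OF x'] sym_H[OF y']
      unfolding f_def by (cases "p u = u"; cases "p v = v"; cases "p w = p u") simp_all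
  qed
  then have "(f u, f v) \<in> parcs H"
    using adj by blast
  then show False
    using xy uv neq by (simp add: f_def)
qed

text \<open>Two distinct leaves could be sent to non-adjacent neighbours \<open>x\<close> and
  \<open>y\<close> of a vertex \<open>c\<close>: every centre goes to \<open>c\<close>,
  \<open>u\<close> to \<open>x\<close>, and all other leaves to \<open>y\<close>.\<close>

lemma star_arc_of_homs_eq:
  assumes p: "star_map V p" and uv: "u \<in> V" "v \<in> V" "u \<noteq> v"
    and adj: "\<forall>f\<in>homs (star_forest V p) H. (f u, f v) \<in> parcs H"
    and H': "power_sum H 1 < (max_deg H)\<^sup>2"
  shows "p u = u \<or> p v = v"
proof (rule ccontr)
  assume leaf: "\<not> ?thesis"
  obtain c x y where c: "(c, x) \<in> parcs H" "(c, y) \<in> parcs H" "(x, y) \<notin> parcs H"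
    using ex_nonadjacent_neighbours[OF H'] by (elim exE conjE)
  define f where "f = restrict (\<lambda>w. if p w = w then c else if w = u then x else y) V"
  have "f \<in> homs (star_forest V p) H"
    using star_mapD(2,3)[OF p] arcs_H[OF c(1)] arcs_H[OF c(2)] sym_H[OF c(1)] sym_H[OF c(2)]
    by (intro homs_star_forestI) (simp_all add: f_def PiE_iff)
  then have "(f u, f v) \<in> parcs H"
    using adj by blast
  then show False
    using c(3) uv leaf by (simp add: f_def)
qed

lemma not_complete_of_less: "power_sum H 1 < (max_deg H)\<^sup>2 \<Longrightarrow> parcs H \<noteq> pverts H \<times> pverts H"
proof
  assume "power_sum H 1 < (max_deg H)\<^sup>2" and eq: "parcs H = pverts H \<times> pverts H"
  then obtain c x y where "(c, x) \<in> parcs H" "(c, y) \<in> parcs H" and xy: "(x, y) \<notin> parcs H"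
    using ex_nonadjacent_neighbours[OF \<open>power_sum H 1 < (max_deg H)\<^sup>2\<close>] by (elim exE conjE)
  then have "x \<in> pverts H" "y \<in> pverts H"
    by (simp_all add: arcs_H)
  then show False
    using xy unfolding eq by simp
qed

text \<open>Used in contrapositive form, to obtain a non-adjacent pair of possibly equal vertices.
  Here every degree is the order of \<open>H\<close>, which identifies
  \<open>max_deg H\<close>.\<close>

lemma looped_complete_iso:
  assumes "parcs H = pverts H \<times> pverts H"
  shows "graph_iso H (looped_complete (max_deg H))"
proof -
  have "parcs H `` {x} = pverts H" if "x \<in> pverts H" for x
    using assms that by auto
  then have "max_deg H = card (pverts H)"
    using max_deg_attained by (metis deg_eq_card_Image)
  then obtain \<phi> where \<phi>: "bij_betw \<phi> (pverts H) {..<max_deg H}"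
    using ex_bij_betw_finite_nat[OF finite_H] by (auto simp: atLeast0LessThan)
  moreover have "{..<max_deg H} \<times> {..<max_deg H} = map_prod \<phi> \<phi> ` parcs H"
    unfolding assms map_prod_surj_on[OF bij_betw_imp_surj_on[OF \<phi>] bij_betw_imp_surj_on[OF \<phi>]] ..
  moreover have "wf_digraph (with_proj H)"
    by (auto simp: wf_digraph_def arcs_H)
  ultimately show ?thesis
    unfolding graph_iso_iff by (auto simp: looped_complete_def)
qed

section \<open>The upper bound\<close>

lemma hom_star_forest_eq:
  "star_map V p \<Longrightarrow> real (hom (star_forest V p) H)
    = (\<Prod>c\<in>centres V p. rate (card (leaves V p c)) ^ (card (leaves V p c) + 1))"
  unfolding hom_star_forest[OF _ H(1)] of_nat_prod power_sum_eq_rate ..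

text \<open>Since the star orders add up to \<open>card V\<close>, the bound splits into one factor
  per star and is compared with the homomorphism count factor by factor. Equality is then forced in
  each star.\<close>

lemma star_forest_bound:
  assumes p: "star_map V p" and le: "\<forall>c\<in>centres V p. card (leaves V p c) \<le> D"
  shows "real (hom (star_forest V p) H) \<le> max (rate 1) (rate D) ^ card V"
    and "real (hom (star_forest V p) H) = max (rate 1) (rate D) ^ card V \<Longrightarrow>
      \<forall>c\<in>centres V p. rate (card (leaves V p c)) = max (rate 1) (rate D)"
proof -
  let ?M = "max (rate 1) (rate D)" and ?k = "\<lambda>c. card (leaves V p c)"
  have bound: "0 < rate (?k c)" "rate (?k c) \<le> ?M" "rate (?k c) ^ (?k c + 1) \<le> ?M ^ (?k c + 1)"
    if "c \<in> centres V p" for c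
    using rate_le_max[of "?k c" D] star_map_leaves(3)[OF p that] le that rate_pos[of "?k c"]
    by (auto intro: power_mono simp del: power_Suc)
  have M: "?M ^ card V = (\<Prod>c\<in>centres V p. ?M ^ (?k c + 1))"
    unfolding card_star_map[OF p] by (rule power_sum)
  show "real (hom (star_forest V p) H) \<le> ?M ^ card V"
    unfolding hom_star_forest_eq[OF p] M using bound by (intro prod_mono) (auto simp: less_imp_le)
  assume "real (hom (star_forest V p) H) = ?M ^ card V"
  then have eq: "(\<Prod>c\<in>centres V p. rate (?k c) ^ (?k c + 1)) = (\<Prod>c\<in>centres V p. ?M ^ (?k c + 1))"
    unfolding hom_star_forest_eq[OF p] M .
  have fin: "finite (centres V p)"
    using star_mapD(1)[OF p] by (simp add: centres_def)
  show "\<forall>c\<in>centres V p. rate (?k c) = ?M"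
  proof
    fix c assume c: "c \<in> centres V p"
    have "rate (?k c) ^ (?k c + 1) = ?M ^ (?k c + 1)"
      using prod_eq_imp_eq[OF fin _ eq c] bound by (simp del: power_Suc)
    then show "rate (?k c) = ?M"
      by (rule power_eq_imp_eq_base) (simp_all add: less_imp_le rate_pos le_max_iff_disj)
  qed
qed

text \<open>Minimum degree 1 without loops supplies the neighbours needed for a spanning star
  forest; leaves are neighbours of their centre, so the maximum degree limits the star
  sizes.\<close>

lemma ex_spanning_star_map:
  assumes G: "G \<in> graph_class n 1 D"
  obtains p where "spanning_star_map (parcs G) (pverts G) p"
    "\<forall>c\<in>centres (pverts G) p. card (leaves (pverts G) p c) \<le> D"
    "parcs (star_forest (pverts G) p) \<subseteq> parcs G"
proof -
  have "pair_graph G" and ne: "pverts G \<noteq> {}" and degs: "min_deg G = 1" "max_deg G \<le> D"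
    using G by (auto simp: graph_class_def)
  interpret pair_graph G by fact
  have sym: "sym (parcs G)"
    using pair_sym_arcs by (simp add: symmetric_def)
  have fin: "finite (pverts G)"
    by (rule pair_finite_verts)
  have deg: "1 \<le> card (parcs G `` {v})" "card (parcs G `` {v}) \<le> D" if "v \<in> pverts G" for v
  proof -
    have "min_deg G \<le> deg G v" "deg G v \<le> max_deg G"
      unfolding min_deg_def max_deg_def using that fin by (auto intro: Min_le Max_ge)
    then show "1 \<le> card (parcs G `` {v})" "card (parcs G `` {v}) \<le> D"
      using degs by (simp_all add: deg_eq_card_Image)
  qed
  have "\<exists>w\<in>pverts G. w \<noteq> v \<and> (v, w) \<in> parcs G" if "v \<in> pverts G" for v
  proof -
    have "parcs G `` {v} \<noteq> {}"
      using deg(1)[OF that] by auto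
    then show ?thesis
      using in_arcsD2 pair_no_loops by force
  qed
  then obtain p where p: "spanning_star_map (parcs G) (pverts G) p"
    using spanning_star_map_exists[OF fin sym] by blast
  then have arcs: "(v, p v) \<in> parcs G" "(p v, v) \<in> parcs G" if "v \<in> pverts G" "p v \<noteq> v" for v
    using that sym by (auto simp: spanning_star_map_def dest: symD)
  have "card (leaves (pverts G) p c) \<le> D" if "c \<in> centres (pverts G) p" for c
  proof -
    have "leaves (pverts G) p c \<subseteq> parcs G `` {c}"
      using arcs(2) by (auto simp: leaves_def)
    moreover have "finite (parcs G `` {c})"
      using fin in_arcsD2 by (auto intro: finite_subset[of _ "pverts G"])
    ultimately have "card (leaves (pverts G) p c) \<le> card (parcs G `` {c})"
      by (rule card_mono[rotated])
    also have "\<dots> \<le> D"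
      using that by (intro deg) (simp add: centres_def)
    finally show ?thesis .
  qed
  moreover have "parcs (star_forest (pverts G) p) \<subseteq> parcs G"
    using arcs by auto
  ultimately show ?thesis
    using that p by blast
qed

text \<open>The count for the spanning star forest lies between that of \<open>G\<close> and the
  bound. Equality makes all three agree, and the nested finite sets of homomorphisms
  coincide.\<close>

lemma hom_le_hom_bound:
  assumes D: "D \<ge> 1" and G: "G \<in> graph_class n 1 D"
  shows "real (hom G H) \<le> hom_bound n D H"
    and "attains_bound n D G H \<Longrightarrow> \<exists>p. star_map (pverts G) p \<and>
      parcs (star_forest (pverts G) p) \<subseteq> parcs G \<and>
      homs G H = homs (star_forest (pverts G) p) H \<and>
      (\<forall>c\<in>centres (pverts G) p. card (leaves (pverts G) p c) \<in> {1..D} \<and>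
        rate (card (leaves (pverts G) p c)) = max (rate 1) (rate D))"
proof -
  obtain p where p: "spanning_star_map (parcs G) (pverts G) p"
    and le: "\<forall>c\<in>centres (pverts G) p. card (leaves (pverts G) p c) \<le> D"
    and sub: "parcs (star_forest (pverts G) p) \<subseteq> parcs G"
    using ex_spanning_star_map[OF G] by blast
  have p': "star_map (pverts G) p"
    using p by (simp add: spanning_star_map_def)
  have n: "card (pverts G) = n"
    using G by (simp add: graph_class_def)
  have homs: "homs G H \<subseteq> homs (star_forest (pverts G) p) H"
    by (intro homs_antimono sub) simp
  have fin: "finite (homs (star_forest (pverts G) p) H)"
    using star_mapD(1)[OF p'] finite_H by (intro finite_homs) auto
  have hom_le: "real (hom G H) \<le> real (hom (star_forest (pverts G) p) H)"
    unfolding hom_def using card_mono[OF fin homs] by simp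
  note bound = star_forest_bound[OF p' le, unfolded n]
  show "real (hom G H) \<le> hom_bound n D H"
    unfolding hom_bound_eq[OF D] using hom_le bound(1) by linarith
  assume "attains_bound n D G H"
  then have eq: "real (hom (star_forest (pverts G) p) H) = max (rate 1) (rate D) ^ n"
    "hom G H = hom (star_forest (pverts G) p) H"
    unfolding attains_bound_def hom_bound_eq[OF D] using hom_le bound(1) by linarith+
  then have "homs G H = homs (star_forest (pverts G) p) H"
    using card_subset_eq[OF fin homs] by (simp add: hom_def)
  moreover have "\<forall>c\<in>centres (pverts G) p. card (leaves (pverts G) p c) \<in> {1..D}"
    using star_map_leaves(3)[OF p'] le by simp
  ultimately show "\<exists>p. star_map (pverts G) p \<and>
      parcs (star_forest (pverts G) p) \<subseteq> parcs G \<and>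
      homs G H = homs (star_forest (pverts G) p) H \<and>
      (\<forall>c\<in>centres (pverts G) p. card (leaves (pverts G) p c) \<in> {1..D} \<and>
        rate (card (leaves (pverts G) p c)) = max (rate 1) (rate D))"
    using p' sub bound(2)[OF eq(1)] by blast
qed

section \<open>Extremal graphs\<close>

text \<open>Arcs between different stars are excluded because \<open>H\<close> is not complete with
  loops. For arcs between leaves of one star, \<open>leafs\<close> offers two grounds: non-adjacent
  neighbours in \<open>H\<close>, or no star with two leaves attaining the maximal rate.\<close>

lemma star_forest_of_attains_bound:
  assumes D: "D \<ge> 1" and G: "G \<in> graph_class n 1 D"
    and att: "attains_bound n D G H" and H': "parcs H \<noteq> pverts H \<times> pverts H"
    and leafs: "power_sum H 1 < (max_deg H)\<^sup>2 \<or> (\<forall>k\<in>{2..D}. rate k \<noteq> max (rate 1) (rate D))"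
  obtains p where "star_map (pverts G) p" "G = star_forest (pverts G) p"
    "\<forall>c\<in>centres (pverts G) p. card (leaves (pverts G) p c) \<in> {1..D} \<and>
      rate (card (leaves (pverts G) p c)) = max (rate 1) (rate D)"
proof -
  obtain p where p: "star_map (pverts G) p" and sub: "parcs (star_forest (pverts G) p) \<subseteq> parcs G"
    and homs: "homs G H = homs (star_forest (pverts G) p) H"
    and sizes: "\<forall>c\<in>centres (pverts G) p. card (leaves (pverts G) p c) \<in> {1..D} \<and>
      rate (card (leaves (pverts G) p c)) = max (rate 1) (rate D)"
    using hom_le_hom_bound(2)[OF D G att] by blast
  have "pair_graph G"
    using G by (simp add: graph_class_def)
  then interpret pair_graph G .
  have "(u, v) \<in> parcs (star_forest (pverts G) p)" if uv: "(u, v) \<in> parcs G" for u v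
  proof -
    have V: "u \<in> pverts G" "v \<in> pverts G" and neq: "u \<noteq> v"
      using in_arcsD1[OF uv] in_arcsD2[OF uv] pair_no_loops[OF uv] by auto
    have adj: "\<forall>f\<in>homs (star_forest (pverts G) p) H. (f u, f v) \<in> parcs H"
      unfolding homs[symmetric] using uv by (auto simp: homs_def)
    have same: "p u = p v"
      by (rule same_star_of_homs_eq[OF p V adj H'])
    have "p u = u \<or> p v = v"
    proof (rule ccontr)
      assume not_centre: "\<not> ?thesis"
      then have "\<not> power_sum H 1 < (max_deg H)\<^sup>2"
        using star_arc_of_homs_eq[OF p V neq adj] by blast
      then have "\<forall>k\<in>{2..D}. rate k \<noteq> max (rate 1) (rate D)"
        using leafs by blast
      moreover have c: "p u \<in> centres (pverts G) p"
        using star_mapD(4)[OF p V(1)] .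
      \<comment> \<open>The two leaves give a star of size at least 2 whose rate is maximal, against
        the second alternative of \<open>leafs\<close>.\<close>
      moreover have "{u, v} \<subseteq> leaves (pverts G) p (p u)"
        using V same not_centre by (auto simp: leaves_def)
      then have "2 \<le> card (leaves (pverts G) p (p u))"
        using card_mono[OF star_map_leaves(1)[OF p c], of "{u, v}"] neq by simp
      ultimately show False
        using sizes by auto
    qed
    then show ?thesis
      using V neq same by auto
  qed
  then have "parcs G = parcs (star_forest (pverts G) p)"
    using sub by (auto simp del: star_forest_simps(2))
  then have "G = star_forest (pverts G) p"
    by (intro pair_pre_digraph.equality) simp_all
  then show ?thesis
    using that p sizes by blast
qed

lemma attains_bound_of_copies_K2:
  assumes "D \<ge> 1" "G \<in> graph_class n 1 D" "is_copies_of G K2" "rate D \<le> rate 1"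
  shows "attains_bound n D G H"
proof -
  obtain m where "card (pverts G) = m * 2" "hom G H = power_sum H 1 ^ m"
    using hom_is_copies_of_K2[OF assms(3) H(1)] by blast
  moreover have "card (pverts G) = n"
    using assms(2) by (simp add: graph_class_def)
  ultimately show ?thesis
    using assms(4) by (simp add: attains_bound_def hom_bound_eq[OF assms(1)] power_sum_1 mult.commute flip: power_mult)
qed

lemma attains_bound_of_copies_star:
  assumes "D \<ge> 1" "G \<in> graph_class n 1 D" "is_copies_of G (complete_bipartite 1 D)" "rate 1 \<le> rate D"
  shows "attains_bound n D G H"
proof -
  obtain m where "card (pverts G) = m * (D + 1)" "hom G H = power_sum H D ^ m"
    using hom_is_copies_of_complete_bipartite[OF assms(3) H(1) assms(1)] by blast
  moreover have "card (pverts G) = n"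
    using assms(2) by (simp add: graph_class_def)
  moreover have "real (power_sum H D) ^ m = rate D ^ (m * (D + 1))"
    unfolding power_sum_eq_rate by (simp only: mult.commute[of m] power_mult)
  ultimately show ?thesis
    using assms(4) by (simp add: attains_bound_def hom_bound_eq[OF assms(1)])
qed

text \<open>\<open>less\<close> leaves 1 as the only star size of maximal rate; at
  \<open>k = D\<close> it says that edges beat the largest star. For \<open>D = 1\<close> the range
  is empty.\<close>

lemma attains_bound_iff_copies_K2:
  assumes D: "D \<ge> 1" and G: "G \<in> graph_class n 1 D" and H': "parcs H \<noteq> pverts H \<times> pverts H"
    and less: "\<forall>k\<in>{2..D}. rate k < max (rate 1) (rate D)"
  shows "attains_bound n D G H \<longleftrightarrow> is_copies_of G K2"
proof
  assume "attains_bound n D G H"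
  then obtain p where p: "star_map (pverts G) p" and eq: "G = star_forest (pverts G) p"
    and sizes: "\<forall>c\<in>centres (pverts G) p. card (leaves (pverts G) p c) \<in> {1..D} \<and>
      rate (card (leaves (pverts G) p c)) = max (rate 1) (rate D)"
    using star_forest_of_attains_bound[OF D G _ H'] less by (metis order_less_irrefl)
  have "k = 1" if "k \<in> {1..D}" "rate k = max (rate 1) (rate D)" for k
  proof (rule ccontr)
    assume "k \<noteq> 1"
    then have "k \<in> {2..D}"
      using that(1) by auto
    then show False
      using bspec[OF less] that(2) by (metis order_less_irrefl)
  qed
  then have "\<forall>c\<in>centres (pverts G) p. card (leaves (pverts G) p c) = 1"
    using sizes by blast
  then show "is_copies_of G K2"
    using is_copies_of_K2[OF p] eq by simp
next
  assume copies: "is_copies_of G K2"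
  have "rate D \<le> rate 1"
  proof (cases "D = 1")
    case False
    then have "D \<in> {2..D}"
      using D by auto
    then have "rate D < max (rate 1) (rate D)"
      using less by blast
    then show ?thesis
      by simp
  qed simp
  then show "attains_bound n D G H"
    by (rule attains_bound_of_copies_K2[OF D G copies])
qed

text \<open>\<open>less\<close> leaves \<open>D\<close> as the only star size of maximal rate; at
  \<open>k = 1\<close> it says that the largest star beats edges.\<close>

lemma attains_bound_iff_copies_star:
  assumes D: "D \<ge> 1" and G: "G \<in> graph_class n 1 D" and H': "power_sum H 1 < (max_deg H)\<^sup>2"
    and less: "\<forall>k\<in>{1..<D}. rate k < max (rate 1) (rate D)"
  shows "attains_bound n D G H \<longleftrightarrow> is_copies_of G (complete_bipartite 1 D)"
proof
  assume "attains_bound n D G H"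
  then obtain p where p: "star_map (pverts G) p" and eq: "G = star_forest (pverts G) p"
    and sizes: "\<forall>c\<in>centres (pverts G) p. card (leaves (pverts G) p c) \<in> {1..D} \<and>
      rate (card (leaves (pverts G) p c)) = max (rate 1) (rate D)"
    using star_forest_of_attains_bound[OF D G _ not_complete_of_less[OF H']] H' by metis
  have "k = D" if "k \<in> {1..D}" "rate k = max (rate 1) (rate D)" for k
  proof (rule ccontr)
    assume "k \<noteq> D"
    then have "k \<in> {1..<D}"
      using that(1) by auto
    then show False
      using bspec[OF less] that(2) by (metis order_less_irrefl)
  qed
  then have "\<forall>c\<in>centres (pverts G) p. card (leaves (pverts G) p c) = D"
    using sizes by blast
  then show "is_copies_of G (complete_bipartite 1 D)"
    using is_copies_of_complete_bipartite[OF p _ D] eq by simp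
next
  assume copies: "is_copies_of G (complete_bipartite 1 D)"
  have "rate 1 \<le> rate D"
  proof (cases "D = 1")
    case False
    then have "1 \<in> {1..<D}"
      using D by auto
    then have "rate 1 < max (rate 1) (rate D)"
      using less by blast
    then show ?thesis
      by simp
  qed simp
  then show "attains_bound n D G H"
    by (rule attains_bound_of_copies_star[OF D G copies])
qed

text \<open>Sizes strictly between 1 and \<open>D\<close> have a rate below the maximum, so only
  edges and largest stars remain. This covers the case of a tie.\<close>

lemma attains_bound_two_sizes:
  assumes D: "D \<ge> 1" and G: "G \<in> graph_class n 1 D" and H': "power_sum H 1 < (max_deg H)\<^sup>2"
    and att: "attains_bound n D G H"
  shows "\<exists>p q. graph_iso G (disjoint_union (copies p K2) (copies q (complete_bipartite 1 D)))"
proof -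
  obtain p where p: "star_map (pverts G) p" and eq: "G = star_forest (pverts G) p"
    and sizes: "\<forall>c\<in>centres (pverts G) p. card (leaves (pverts G) p c) \<in> {1..D} \<and>
      rate (card (leaves (pverts G) p c)) = max (rate 1) (rate D)"
    using star_forest_of_attains_bound[OF D G att not_complete_of_less[OF H']] H' by metis
  have "k \<in> {1, D}" if "k \<in> {1..D}" "rate k = max (rate 1) (rate D)" for k
  proof (rule ccontr)
    assume "k \<notin> {1, D}"
    then have "1 < k" "k < D"
      using that(1) by auto
    then show False
      using rate_less_max[OF _ _ not_complete_of_less[OF H']] that(2) by fastforce
  qed
  then have "\<forall>c\<in>centres (pverts G) p. card (leaves (pverts G) p c) \<in> {1, D}"
    using sizes by blast
  then show ?thesis
    using two_size_star_forest_iso[OF p _ D] eq by simp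
qed

text \<open>Translates the exceptional condition at \<open>m = n0\<close>: a star on
  \<open>m - 1\<close> vertices has \<open>m - 2\<close> leaves.\<close>

lemma edges_eq_star_iff:
  assumes "m \<ge> 3"
  shows "real (hom K2 H) = real (hom (complete_bipartite 1 (m - 2)) H) powr (2 / real (m - 1))
    \<longleftrightarrow> rate 1 = rate (m - 2)"
proof -
  have "real (power_sum H (m - 2)) powr (2 / real (m - 1)) = (rate (m - 2))\<^sup>2"
    using rate_powr[of "m - 2" 2] assms by (simp add: numeral_2_eq_2 One_nat_def Suc_diff_Suc)
  moreover have "1 \<le> m - 2"
    using assms by simp
  ultimately show ?thesis
    unfolding hom_K2[OF H(1)] hom_complete_bipartite[OF H(1) \<open>1 \<le> m - 2\<close>] power_sum_1
    using rate_pos[of 1] rate_pos[of "m - 2"] by (simp add: power2_eq_iff_nonneg less_imp_le)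
qed

end

text \<open>It is \<open>D + 1\<close>, the order of the largest available star, that is compared
  with \<open>n0\<close>, because \<open>complete_bipartite 1 D\<close> replaces the star on all
  \<open>n\<close> vertices. In the exceptional case edges and such stars have equal rates, hence
  the mixtures there.\<close>

theorem theorem1p8:
  fixes G :: "'a pair_pre_digraph" and H :: "'b pair_pre_digraph" and n D :: nat
  assumes H: "pair_pseudo_graph H" "pverts H \<noteq> {}" "\<not> (\<exists>v. isolated H v)"
    and D: "D \<ge> 1"
    and G: "G \<in> graph_class n 1 D"
  shows "real (hom G H) \<le> hom_bound n D H
    \<and> (\<not> graph_iso H (looped_complete (max_deg H)) \<and> hom K2 H \<ge> (max_deg H)\<^sup>2 \<longrightarrow>
        (attains_bound n D G H \<longleftrightarrow> is_copies_of G K2))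
    \<and> (hom K2 H < (max_deg H)\<^sup>2 \<longrightarrow>
        (\<exists>n0. is_n0 H n0 \<and>
          (D + 1 < n0 \<longrightarrow>
            (if D + 1 = n0 - 1 \<and>
                real (hom K2 H) = real (hom (complete_bipartite 1 (n0 - 2)) H) powr (2 / real (n0 - 1))
             then (is_copies_of G K2 \<longrightarrow> attains_bound n D G H) \<and>
                  (is_copies_of G (complete_bipartite 1 D) \<longrightarrow> attains_bound n D G H) \<and>
                  (attains_bound n D G H \<longrightarrow>
                    (\<exists>p q. graph_iso G
                      (disjoint_union (copies p K2) (copies q (complete_bipartite 1 D)))))
             else (attains_bound n D G H \<longleftrightarrow> is_copies_of G K2))) \<and>
          (D + 1 \<ge> n0 \<longrightarrow>
            (attains_bound n D G H \<longleftrightarrow> is_copies_of G (complete_bipartite 1 D)))))"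
proof -
  interpret target_graph H
    by (rule target_graph.intro[OF H])
  have edges: "attains_bound n D G H \<longleftrightarrow> is_copies_of G K2"
    if "\<not> graph_iso H (looped_complete (max_deg H))" "hom K2 H \<ge> (max_deg H)\<^sup>2"
  proof -
    have H': "parcs H \<noteq> pverts H \<times> pverts H"
      using looped_complete_iso that(1) by blast
    have "rate k < rate 1" if "k \<ge> 2" for k
      using rate_less_of_edges[OF H' _ that] \<open>hom K2 H \<ge> (max_deg H)\<^sup>2\<close> hom_K2[OF H(1)] by simp
    then show ?thesis
      by (intro attains_bound_iff_copies_K2[OF D G H']) (auto simp: less_max_iff_disj)
  qed
  have stars: "\<exists>n0. is_n0 H n0 \<and>
      (D + 1 < n0 \<longrightarrow>
        (if D + 1 = n0 - 1 \<and>
            real (hom K2 H) = real (hom (complete_bipartite 1 (n0 - 2)) H) powr (2 / real (n0 - 1))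
         then (is_copies_of G K2 \<longrightarrow> attains_bound n D G H) \<and>
              (is_copies_of G (complete_bipartite 1 D) \<longrightarrow> attains_bound n D G H) \<and>
              (attains_bound n D G H \<longrightarrow>
                (\<exists>p q. graph_iso G
                  (disjoint_union (copies p K2) (copies q (complete_bipartite 1 D)))))
         else (attains_bound n D G H \<longleftrightarrow> is_copies_of G K2))) \<and>
      (D + 1 \<ge> n0 \<longrightarrow>
        (attains_bound n D G H \<longleftrightarrow> is_copies_of G (complete_bipartite 1 D)))"
    if "hom K2 H < (max_deg H)\<^sup>2"
  proof -
    have lt: "power_sum H 1 < (max_deg H)\<^sup>2"
      using that hom_K2[OF H(1)] by simp
    note H' = not_complete_of_less[OF lt]
    define n0 where "n0 = (LEAST m. star_beats_edges H m)"
    have beats: "star_beats_edges H n0"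
      unfolding n0_def using ex_star_beats_edges[OF lt] by (rule LeastI_ex)
    have least: "n0 \<le> m" if "star_beats_edges H m" for m
      unfolding n0_def using that by (rule Least_le)
    have n0: "n0 \<ge> 3" "rate 1 < rate (n0 - 1)"
      using beats by (simp_all add: star_beats_edges_iff)
    \<comment> \<open>This is the minimality of \<open>n0\<close>; \<open>k = 1\<close> is separate
      because \<open>star_beats_edges\<close> only concerns orders from 3 on.\<close>
    have below: "rate k \<le> rate 1" if "k + 1 < n0" "k \<ge> 1" for k
    proof (cases "k = 1")
      case False
      have "\<not> star_beats_edges H (k + 1)"
        using least[of "k + 1"] that(1) by auto
      then show ?thesis
        using False that(2) by (simp add: star_beats_edges_iff not_less)
    qed simp
    have exceptional: "rate D = rate 1"
      if "D + 1 = n0 - 1" "real (hom K2 H)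
        = real (hom (complete_bipartite 1 (n0 - 2)) H) powr (2 / real (n0 - 1))"
    proof -
      have "n0 - 2 = D"
        using that(1) by simp
      then show ?thesis
        using that(2) edges_eq_star_iff[OF n0(1)] by simp
    qed
    have few: "attains_bound n D G H \<longleftrightarrow> is_copies_of G K2"
      if Dn: "D + 1 < n0" and not_exc: "\<not> (D + 1 = n0 - 1 \<and> real (hom K2 H)
        = real (hom (complete_bipartite 1 (n0 - 2)) H) powr (2 / real (n0 - 1)))"
    proof (intro attains_bound_iff_copies_K2[OF D G H'] ballI)
      fix k assume k: "k \<in> {2..D}"
      \<comment> \<open>For \<open>D = n0 - 2\<close> the weak inequality is strict because the tie
        is excluded. Smaller \<open>D\<close> lie strictly between 1 and \<open>n0 - 2\<close>,
        whose rates are at most \<open>rate 1\<close>.\<close>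
      have "rate D < rate 1"
      proof (cases "D + 1 = n0 - 1")
        case True
        then have "n0 - 2 = D"
          by simp
        then have "rate D \<noteq> rate 1"
          using True not_exc edges_eq_star_iff[OF n0(1)] by auto
        then show ?thesis
          using below[OF Dn D] by simp
      next
        case False
        then have "D < n0 - 2" "1 < D"
          using Dn k by auto
        then show ?thesis
          using rate_less_max[of D "n0 - 2", OF _ _ H'] below[of "n0 - 2"] by simp
      qed
      then show "rate k < max (rate 1) (rate D)"
        using rate_less_max[of k D, OF _ _ H'] k by (cases "k = D") auto
    qed
    have many: "attains_bound n D G H \<longleftrightarrow> is_copies_of G (complete_bipartite 1 D)" if Dn: "D + 1 \<ge> n0"
    proof (intro attains_bound_iff_copies_star[OF D G lt] ballI)
      fix k assume k: "k \<in> {1..<D}"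
      \<comment> \<open>The star with \<open>n0 - 1\<close> leaves beats edges and is no larger than
        the largest one, so the maximum must be \<open>rate D\<close>.\<close>
      have "rate (n0 - 1) \<le> max (rate 1) (rate D)"
        using n0(1) Dn by (intro rate_le_max) auto
      then have "rate 1 < rate D"
        using n0(2) by simp
      then show "rate k < max (rate 1) (rate D)"
        using rate_less_max[of k D, OF _ _ H'] k by (cases "k = 1") auto
    qed
    have "is_n0 H n0"
      using beats least by (simp add: is_n0_def)
    then show ?thesis
      using few many exceptional attains_bound_of_copies_K2[OF D G] attains_bound_of_copies_star[OF D G]
        attains_bound_two_sizes[OF D G lt]
      by (intro exI[of _ n0]) auto
  qed
  show ?thesis
    using hom_le_hom_bound(1)[OF D G] edges stars by blast
qed

end
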